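(* Let $\Sigma_{\mathsf{zkLogin}}$ be the Tagged Witness Signature scheme for the predicate $P_{\mathsf{zkLogin}}$, and let $\mathsf{zkLogin}=(\mathsf{zkLoginGen},\mathsf{zkLoginSign},\mathsf{GetWitness},\mathsf{zkLoginVerify})$ be the scheme constructed from it, both as described in the context. If $\Sigma_{\mathsf{zkLogin}}$ satisfies witness hiding and the addresses $\mathsf{zkaddr}$ are computed as hiding commitments to the claim sets, then $\mathsf{zkLogin}$ achieves unlinkability: for all PPT adversaries $\mathcal{A}=(\mathcal{A}_1,\mathcal{A}_2)$, $$\left|\Pr[\mathbf{Game}^{\mathsf{UL}}_{\mathcal{A},\mathsf{zkLogin}}(1^\lambda)=1]-1/2\right|\le\mathsf{negl}(\lambda).$$
   Context: **Tagged Witness Signature (TWS).** For a predicate $P:\{0,1\}^*\times\{0,1\}^*\to\{0,1\}$ (inputs: public tag $t$, secret witness $w$), a TWS is a triple $(\mathsf{Gen},\mathsf{Sign},\mathsf{Verify})$ with $\mathsf{Gen}(1^\lambda)\to pk$, $\mathsf{Sign}(t,pk,w,m)\to\sigma$, $\mathsf{Verify}(t,pk,m,\sigma)\to 0/1$. **Witness hiding** of a TWS: for all PPT $\mathcal{A}$ there exist simulators $(\mathsf{SimGen},\mathsf{SimSign})$ with $|\Pr[\textbf{Expt-Real}_{\mathcal{A}}(1^\lambda)=1]-\Pr[\textbf{Expt-Sim}_{\mathcal{A}}(1^\lambda)=1]|\le\mathsf{negl}(\lambda)$, where - $\textbf{Expt-Real}_{\mathcal{A}}(1^\lambda)$: $pk\gets\mathsf{Gen}(1^\lambda)$;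 return $b\gets\mathcal{A}^{\mathcal{O}^{\mathsf{Sign}}(\cdot,\cdot)}(pk)$, with $\mathcal{O}^{\mathsf{Sign}}(t,m)$ obtaining $w$ with $P(t,w)=1$ and returning $\mathsf{Sign}(t,pk,w,m)$; - $\textbf{Expt-Sim}_{\mathcal{A}}(1^\lambda)$: $(pk,\mathsf{trap})\gets\mathsf{SimGen}(1^\lambda)$; return $b\gets\mathcal{A}^{\mathcal{O}^{\mathsf{SimSign}}(\cdot,\cdot)}(pk)$, with $\mathcal{O}^{\mathsf{SimSign}}(t,m)$ returning $\mathsf{SimSign}(t,pk,\mathsf{trap},m)$. **JWTs.** An OpenID Provider (OP), identified by an issuer string $\mathsf{iss}$, is trusted and holds a fixed, honestly generated signing key pair $(sk_{OP},pk_{OP})$; the public key is published (as the "JWK of $\mathsf{iss}$") and is obtained correctly by all parties. $JWT.\mathsf{Issue}(sk_{OP},\mathcal{C})\to\mathsf{jwt}$ signs a claim set $\mathcal{C}=\{\mathsf{stid},\mathsf{aud},\mathsf{iss},\mathsf{nonce},\dots\}$ (stable user identifier, application identifier, issuer, nonce), and $JWT.\mathsf{Verify}(pk_{OP},\mathsf{jwt})\in\{0,1\}$ checks the signature. $\mathsf{jwt}.x$ (resp. $\mathcal{C}.x$) denotes the value of claim $x$. $H$ is a hash function and $Sig$ a signature scheme. **Addresses.** The address constructed from a claim set $\mathcal{C}$ is $\mathsf{zkaddr}=H(\mathcal{C}.\mathsf{stid},\mathcal{C}.\mathsf{aud},\mathcal{C}.\mathsf{iss},\mathsf{salt})$, where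 $\mathsf{salt}$ is the user's persistent secret randomness. That addresses are hiding commitments to the claim sets means that this is a (computationally) hiding commitment to the claims, with commitment randomness $\mathsf{salt}$. **Predicate $P_{\mathsf{zkLogin}}$.** For $t=\mathsf{tag}=(pk_{OP},\mathsf{iss},\mathsf{zkaddr},T)$ and $w=(\mathsf{jwt},\mathsf{salt},r,vk_u,sk_u)$, $P_{\mathsf{zkLogin}}(t,w)=1$ iff: $\mathsf{zkaddr}=H(\mathsf{jwt}.\mathsf{stid},\mathsf{jwt}.\mathsf{aud},\mathsf{jwt}.\mathsf{iss},\mathsf{salt})$; $\mathsf{jwt}.\mathsf{iss}=\mathsf{iss}$; $\mathsf{jwt}.\mathsf{nonce}=H(vk_u,T,r)$; $JWT.\mathsf{Verify}(pk_{OP},\mathsf{jwt})=1$; and $(sk_u,vk_u)$ is a valid key pair of $Sig$. **Relation $\mathsf{Ckt}$.** For statement $\mathsf{zkx}=(pk_{OP},\mathsf{iss},\mathsf{zkaddr},T,vk_u)$ and witness $\mathsf{zkw}=(\mathsf{jwt},\mathsf{salt},r)$, $\mathsf{Ckt}(\mathsf{zkx},\mathsf{zkw})$ holds iff: $\mathsf{zkaddr}=H(\mathsf{jwt}.\mathsf{stid},\mathsf{jwt}.\mathsf{aud},\mathsf{jwt}.\mathsf{iss},\mathsf{salt})$; $\mathsf{jwt}.\mathsf{iss}=\mathsf{iss}$; $\mathsf{jwt}.\mathsf{nonce}=H(vk_u,T,r)$; and $JWT.\mathsf{Verify}(pk_{OP},\mathsf{jwt})=1$ (validity of a key pair of $Sig$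 is not part of this relation). **Scheme $\Sigma_{\mathsf{zkLogin}}$.** Let $\Pi=(\mathsf{Gen},\mathsf{Prove},\mathsf{Verify})$ be a NIZK scheme in the CRS model. - $\mathsf{Gen}(1^\lambda)$: output $pk=zkcrs\gets\Pi.\mathsf{Gen}(1^\lambda,\mathsf{Ckt})$. - $\mathsf{Sign}(\mathsf{tag},pk,w,M)$: parse $\mathsf{tag}=(pk_{OP},\mathsf{iss},\mathsf{zkaddr},T)$, $pk=zkcrs$, $w=(\mathsf{jwt},\mathsf{salt},r,vk_u,sk_u)$; set $\sigma_u\gets Sig.\mathsf{Sign}(sk_u,M)$, $\mathsf{zkx}\gets(pk_{OP},\mathsf{iss},\mathsf{zkaddr},T,vk_u)$, $\mathsf{zkw}\gets(\mathsf{jwt},\mathsf{salt},r)$, $\pi\gets\Pi.\mathsf{Prove}(zkcrs,\mathsf{zkx},\mathsf{zkw})$; output $\sigma=(vk_u,T,\sigma_u,\pi)$. - $\mathsf{Verify}(\mathsf{tag},pk,M,\sigma)$: parse $\mathsf{tag}=(pk_{OP},\mathsf{iss},\mathsf{zkaddr},T)$ and $\sigma=(vk_u,T,\sigma_u,\pi)$ (same $T$); set $\mathsf{zkx}\gets(pk_{OP},\mathsf{iss},\mathsf{zkaddr},T,vk_u)$; accept iff $\sigma_u$ verifies under $Sig$ with key $vk_u$ on $M$, and $\Pi.\mathsf{Verify}(zkcrs,\mathsf{zkx},\pi)=1$. **Scheme $\mathsf{zkLogin}$.** - $\mathsf{zkLoginGen}(1^\lambda)$: output $pk\gets\Sigma_{\mathsf{zkLogin}}.\mathsf{Gen}(1^\lambda)$.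 - $\mathsf{GetWitness}(\mathsf{iss},\mathsf{zkaddr},T_{exp})$: obtain $pk_{OP}$ from the JWK of $\mathsf{iss}$; sample $(vk_u,sk_u)\gets Sig.\mathsf{Gen}(1^\lambda)$ and $r\gets\{0,1\}^\lambda$; set $\mathsf{nonce}\gets H(vk_u,T_{exp},r)$; obtain $\mathsf{stid},\mathsf{aud},\mathsf{salt}$ from the user/app (with $\mathsf{zkaddr}=H(\mathsf{stid},\mathsf{aud},\mathsf{iss},\mathsf{salt})$); obtain $\mathsf{jwt}\gets JWT.\mathsf{Issue}(sk_{OP},\{\mathsf{stid},\mathsf{aud},\mathsf{iss},\mathsf{nonce}\})$ from the OP; output the witness $w\gets(\mathsf{jwt},\mathsf{salt},r,vk_u,sk_u)$ together with $pk_{OP}$. - $\mathsf{zkLoginSign}(pk,\mathsf{zkaddr},\mathsf{iss},M,T_{exp})$: obtain $(w,pk_{OP})\gets\mathsf{GetWitness}(\mathsf{iss},\mathsf{zkaddr},T_{exp})$; let $\mathsf{tag}\gets(pk_{OP},\mathsf{iss},\mathsf{zkaddr},T_{exp})$; output $\Sigma_{\mathsf{zkLogin}}.\mathsf{Sign}(\mathsf{tag},pk,w,M)$. - $\mathsf{zkLoginVerify}(pk,\mathsf{zkaddr},\mathsf{iss},M,\sigma,T_{cur})$: output $0$ if $T_{cur}>\sigma.T$; obtain $pk_{OP}$ from the JWK of $\mathsf{iss}$; let $\mathsf{tag}\gets(pk_{OP},\mathsf{iss},\mathsf{zkaddr},\sigma.T)$; output $\Sigma_{\mathsf{zkLogin}}.\mathsf{Verify}(\mathsf{tag},pk,M,\sigma)$.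 In the witness-hiding experiments for $\Sigma_{\mathsf{zkLogin}}$, "obtain $w$" for a tag $(pk_{OP},\mathsf{iss},\mathsf{zkaddr},T)$ is carried out by the procedure $\mathsf{GetWitness}(\mathsf{iss},\mathsf{zkaddr},T)$, and $pk_{OP}$ in tags is the issuer's correct key. Oracle queries are on inputs for which a witness can be so obtained. **Unlinkability game** $\mathbf{Game}^{\mathsf{UL}}_{\mathcal{A},\mathsf{zkLogin}}(1^\lambda)$: $pk\gets\mathsf{zkLoginGen}(1^\lambda)$; sample a uniform bit $b$; $(\mathcal{C}_0,\mathcal{C}_1,st)\gets\mathcal{A}_1(pk)$; if $\mathcal{C}_0.\mathsf{iss}\ne\mathcal{C}_1.\mathsf{iss}$, return $b$; construct $\mathsf{zkaddr}$ from $\mathcal{C}_b$; $b'\gets\mathcal{A}_2^{\mathcal{O}^{\mathsf{zkLoginSign}}(\cdot)}(st,\mathsf{zkaddr})$; return $1$ iff $b'=b$. The claim sets $\mathcal{C}_0,\mathcal{C}_1$ must both correspond to honest users (not controlled by the adversary). The oracle $\mathcal{O}^{\mathsf{zkLoginSign}}(\mathsf{zkaddr},\mathsf{iss},m,T_{exp})$ returns $\mathsf{zkLoginSign}(pk,\mathsf{zkaddr},\mathsf{iss},m,T_{exp})$; the adversary may query it for addresses of its choosing, and it has no oracle access to $\mathsf{GetWitness}$. *)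

theory Defs
  imports
    "HOL-Probability.Probability_Mass_Function"
    "HOL-Computational_Algebra.Polynomial"
begin

section \<open>Data\<close>

text \<open>
  Binary trees play the role of \<open>{0,1}\<^sup>*\<close>: bits, bit strings, numbers in unary and tuples of
  such values are all trees, so that no separate pairing function on strings has to be fixed.
\<close>

datatype data = Leaf | Node data data

primrec left :: "data \<Rightarrow> data" where
  "left Leaf = Leaf"
| "left (Node a b) = a"

primrec right :: "data \<Rightarrow> data" where
  "right Leaf = Leaf"
| "right (Node a b) = b"

definition tup :: "data list \<Rightarrow> data" where
  "tup xs = foldr Node xs Leaf"

text \<open>Parsing is total: \<open>item i (tup xs) = xs ! i\<close> for \<open>i < length xs\<close>, and absent components of
  ill-formed data are read as \<open>Leaf\<close>.\<close>

definition item :: "nat \<Rightarrow> data \<Rightarrow> data" where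
  "item i d = left ((right ^^ i) d)"

definition bit :: "bool \<Rightarrow> data" where
  "bit b = (if b then Node Leaf Leaf else Leaf)"

definition to_bool :: "data \<Rightarrow> bool" where
  "to_bool d \<longleftrightarrow> d \<noteq> Leaf"

definition unary :: "nat \<Rightarrow> data" where
  "unary n = tup (replicate n Leaf)"

text \<open>Value of a binary numeral, least significant bit first.\<close>

primrec numeral_value :: "data \<Rightarrow> nat" where
  "numeral_value Leaf = 0"
| "numeral_value (Node b d) = of_bool (to_bool b) + 2 * numeral_value d"

definition coin :: "bool pmf" where
  "coin = bernoulli_pmf (1/2)"

definition bitstring :: "nat \<Rightarrow> data pmf" where
  "bitstring n = map_pmf (\<lambda>bs. tup (map bit bs)) (pmf_of_set {bs :: bool list. length bs = n})"


section \<open>Probabilistic algorithms with oracles\<close>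

text \<open>
  The behaviour of a halting algorithm on a fixed input: a tree branching on coin tosses and on
  the answers of oracles. \<open>Ask i q k\<close> queries the \<open>i\<close>-th of them on \<open>q\<close>.
\<close>

datatype 'a itree =
    Ret 'a
  | Coin "bool \<Rightarrow> 'a itree"
  | Ask nat data "data \<Rightarrow> 'a itree"

primrec bind_itree :: "'a itree \<Rightarrow> ('a \<Rightarrow> 'b itree) \<Rightarrow> 'b itree" where
  "bind_itree (Ret a) f = f a"
| "bind_itree (Coin k) f = Coin (\<lambda>b. bind_itree (k b) f)"
| "bind_itree (Ask i q k) f = Ask i q (\<lambda>a. bind_itree (k a) f)"

type_synonym 's responder = "'s \<Rightarrow> nat \<Rightarrow> data \<Rightarrow> (data \<times> 's) pmf"

primrec run :: "'s responder \<Rightarrow> 'a itree \<Rightarrow> 's \<Rightarrow> ('a \<times> 's) pmf" where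
  "run orc (Ret a) s = return_pmf (a, s)"
| "run orc (Coin k) s = bind_pmf coin (\<lambda>b. run orc (k b) s)"
| "run orc (Ask i q k) s = bind_pmf (orc s i q) (\<lambda>(a, s'). run orc (k a) s')"

text \<open>Execution without oracles; the queries of an algorithm that makes some are answered
  by \<open>Leaf\<close>.\<close>

definition sample :: "'a itree \<Rightarrow> 'a pmf" where
  "sample t = map_pmf fst (run (\<lambda>s i q. return_pmf (Leaf, s)) t ())"


section \<open>Probabilistic polynomial time\<close>

text \<open>
  The machine model is the language of WHILE programs over trees, extended with coin tosses and
  queries to oracles. Selecting a component or copying a variable is a pointer operation of cost 1.
  Building a node is charged the size of the result, a comparison the size of the smaller operand
  and a query the size of the query, so that no program produces data of more than polynomial
  size in polynomial time; up to polynomials this is Turing machine time.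
\<close>

datatype expr =
    Const data
  | Var nat
  | Mk expr expr
  | Left expr
  | Right expr
  | Equal expr expr

type_synonym store = "nat \<Rightarrow> data"

primrec eval :: "expr \<Rightarrow> store \<Rightarrow> data" where
  "eval (Const d) s = d"
| "eval (Var x) s = s x"
| "eval (Mk e1 e2) s = Node (eval e1 s) (eval e2 s)"
| "eval (Left e) s = left (eval e s)"
| "eval (Right e) s = right (eval e s)"
| "eval (Equal e1 e2) s = bit (eval e1 s = eval e2 s)"

primrec cost :: "expr \<Rightarrow> store \<Rightarrow> nat" where
  "cost (Const d) s = 1 + size d"
| "cost (Var x) s = 1"
| "cost (Mk e1 e2) s = cost e1 s + cost e2 s + 1 + size (Node (eval e1 s) (eval e2 s))"
| "cost (Left e) s = cost e s + 1"
| "cost (Right e) s = cost e s + 1"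
| "cost (Equal e1 e2) s = cost e1 s + cost e2 s + 1 + min (size (eval e1 s)) (size (eval e2 s))"

datatype cmd =
    Assign nat expr
  | Toss nat
  | Query nat nat expr
  | Seq cmd cmd
  | If expr cmd cmd
  | While expr cmd

text \<open>
  \<open>exec c s t n\<close>: started in the store \<open>s\<close>, the program \<open>c\<close> halts within time \<open>n\<close> for all coin
  tosses and all answers of oracles, and \<open>t\<close> is its behaviour.
\<close>

inductive exec :: "cmd \<Rightarrow> store \<Rightarrow> store itree \<Rightarrow> nat \<Rightarrow> bool" where
  Assign: "cost e s < n \<Longrightarrow> exec (Assign x e) s (Ret (s(x := eval e s))) n"
| Toss: "0 < n \<Longrightarrow> exec (Toss x) s (Coin (\<lambda>b. Ret (s(x := bit b)))) n"
| Query: "cost e s + size (eval e s) < n \<Longrightarrow>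
    exec (Query x i e) s (Ask i (eval e s) (\<lambda>a. Ret (s(x := a)))) n"
| Seq: "exec c1 s t m \<Longrightarrow> (\<And>s'. s' \<in> set_itree t \<Longrightarrow> exec c2 s' (f s') n) \<Longrightarrow>
    exec (Seq c1 c2) s (bind_itree t f) (m + n)"
| If_True: "to_bool (eval e s) \<Longrightarrow> exec c1 s t n \<Longrightarrow> exec (If e c1 c2) s t (cost e s + 1 + n)"
| If_False: "\<not> to_bool (eval e s) \<Longrightarrow> exec c2 s t n \<Longrightarrow> exec (If e c1 c2) s t (cost e s + 1 + n)"
| While_False: "\<not> to_bool (eval e s) \<Longrightarrow> cost e s < n \<Longrightarrow> exec (While e c) s (Ret s) n"
| While_True: "to_bool (eval e s) \<Longrightarrow> exec c s t m \<Longrightarrow>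
    (\<And>s'. s' \<in> set_itree t \<Longrightarrow> exec (While e c) s' (f s') n) \<Longrightarrow>
    exec (While e c) s (bind_itree t f) (cost e s + 1 + m + n)"

text \<open>
  The input is passed and the output returned in variable 0. As usual for algorithms with
  oracles, the time bound depends on the input only and has to hold whatever the oracles answer.
\<close>

definition ppt :: "(data \<Rightarrow> data itree) \<Rightarrow> bool" where
  "ppt A \<longleftrightarrow> (\<exists>c. \<exists>p :: nat poly. \<forall>x. \<exists>t.
     exec c ((\<lambda>_. Leaf)(0 := x)) t (poly p (size x)) \<and> A x = map_itree (\<lambda>s. s 0) t)"

text \<open>PPT algorithms without oracles, for given encodings of their inputs and outputs.\<close>

definition ppt_alg :: "('a \<Rightarrow> data) \<Rightarrow> ('b \<Rightarrow> data) \<Rightarrow> ('a \<Rightarrow> 'b pmf) \<Rightarrow> bool" where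
  "ppt_alg enc_in enc_out f \<longleftrightarrow>
     (\<exists>A. ppt A \<and> (\<forall>x. sample (A (enc_in x)) = map_pmf enc_out (f x)))"

definition negligible :: "(nat \<Rightarrow> real) \<Rightarrow> bool" where
  "negligible f \<longleftrightarrow> (\<forall>k :: nat. \<forall>\<^sub>F n in sequentially. \<bar>f n\<bar> < 1 / real n ^ k)"


section \<open>Tagged witness signatures and witness hiding\<close>

record tws =
  tws_gen :: "nat \<Rightarrow> data pmf"
  tws_sign :: "data \<Rightarrow> data \<Rightarrow> data \<Rightarrow> data \<Rightarrow> data pmf"  (* tag, public key, witness, message *)
  tws_verify :: "data \<Rightarrow> data \<Rightarrow> data \<Rightarrow> data \<Rightarrow> bool"  (* tag, public key, message, signature *)

text \<open>
  The parties from which the experiments obtain witnesses. \<open>env_init\<close> samples their initial state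
  together with the data they publish; \<open>env_register\<close> is the effect of registering a user chosen
  by the adversary; \<open>env_obtain\<close> obtains a witness for a tag, with result \<open>None\<close> if there is no
  party from which one can be obtained.
\<close>

record 'e witness_env =
  env_init :: "nat \<Rightarrow> ('e \<times> data) pmf"
  env_register :: "'e \<Rightarrow> data \<Rightarrow> 'e"
  env_obtain :: "nat \<Rightarrow> 'e \<Rightarrow> data \<Rightarrow> data pmf option"

text \<open>
  Index 0 is for signing queries, of the form \<open>tup [t, m]\<close>; any other index registers a user.
  The flag in the state records a signing query for which no witness could be obtained.
\<close>

definition real_oracle ::
  "(data \<Rightarrow> data \<Rightarrow> bool) \<Rightarrow> 'e witness_env \<Rightarrow> tws \<Rightarrow> nat \<Rightarrow> data \<Rightarrow> ('e \<times> bool) responder" where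
  "real_oracle P E S n pk = (\<lambda>(e, bad) i q.
     if i = 0 then
       (let t = item 0 q; m = item 1 q in
        case env_obtain E n e t of
          None \<Rightarrow> return_pmf (Leaf, (e, True))
        | Some W \<Rightarrow> do {
            w \<leftarrow> W;
            if P t w then do {
              \<sigma> \<leftarrow> tws_sign S t pk w m;
              return_pmf (\<sigma>, (e, bad))
            } else return_pmf (Leaf, (e, True))
          })
     else return_pmf (Leaf, (env_register E e q, bad)))"

definition sim_oracle ::
  "(data \<Rightarrow> data \<Rightarrow> data \<Rightarrow> data \<Rightarrow> data pmf) \<Rightarrow> data \<Rightarrow> data \<Rightarrow> unit responder" where
  "sim_oracle SimSign pk trap = (\<lambda>_ i q.
     if i = 0 then do {
       \<sigma> \<leftarrow> SimSign (item 0 q) pk trap (item 1 q);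
       return_pmf (\<sigma>, ())
     } else return_pmf (Leaf, ()))"

text \<open>The second component of the outcome is the final value of the flag.\<close>

definition expt_real ::
  "(data \<Rightarrow> data \<Rightarrow> bool) \<Rightarrow> 'e witness_env \<Rightarrow> tws \<Rightarrow> (data \<Rightarrow> data itree) \<Rightarrow> nat \<Rightarrow> (bool \<times> bool) pmf"
where
  "expt_real P E S A n = do {
     (e, pub) \<leftarrow> env_init E n;
     pk \<leftarrow> tws_gen S n;
     (out, (e', bad)) \<leftarrow> run (real_oracle P E S n pk) (A (tup [unary n, pk, pub])) (e, False);
     return_pmf (to_bool out, bad)
   }"

definition expt_sim ::
  "'e witness_env \<Rightarrow> (nat \<Rightarrow> (data \<times> data) pmf) \<Rightarrow> (data \<Rightarrow> data \<Rightarrow> data \<Rightarrow> data \<Rightarrow> data pmf) \<Rightarrow>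
   (data \<Rightarrow> data itree) \<Rightarrow> nat \<Rightarrow> bool pmf"
where
  "expt_sim E SimGen SimSign A n = do {
     (e, pub) \<leftarrow> env_init E n;
     (pk, trap) \<leftarrow> SimGen n;
     (out, _) \<leftarrow> run (sim_oracle SimSign pk trap) (A (tup [unary n, pk, pub])) ();
     return_pmf (to_bool out)
   }"

definition witness_hiding ::
  "(data \<Rightarrow> data \<Rightarrow> bool) \<Rightarrow> 'e witness_env \<Rightarrow> tws \<Rightarrow> bool" where
  "witness_hiding P E S \<longleftrightarrow>
     (\<forall>A. ppt A \<longrightarrow> (\<forall>n. \<forall>(out, bad) \<in> set_pmf (expt_real P E S A n). \<not> bad) \<longrightarrow>
        (\<exists>SimGen SimSign.
           ppt_alg unary (\<lambda>(pk, trap). tup [pk, trap]) SimGen \<and>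
           ppt_alg (\<lambda>(t, pk, trap, m). tup [t, pk, trap, m]) id
             (\<lambda>(t, pk, trap, m). SimSign t pk trap m) \<and>
           negligible (\<lambda>n. \<bar>pmf (map_pmf fst (expt_real P E S A n)) True
                             - pmf (expt_sim E SimGen SimSign A n) True\<bar>)))"


section \<open>Building blocks\<close>

record claims =
  stid :: data
  aud :: data
  iss :: data
  nonce :: data

definition decode_claims :: "data \<Rightarrow> claims" where
  "decode_claims d = \<lparr>stid = item 0 d, aud = item 1 d, iss = item 2 d, nonce = item 3 d\<rparr>"

record jwt_scheme =
  jwt_gen :: "nat \<Rightarrow> (data \<times> data) pmf"  (* secret key, public key *)
  jwt_issue :: "data \<Rightarrow> claims \<Rightarrow> data pmf"
  jwt_verify :: "data \<Rightarrow> data \<Rightarrow> bool"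
  jwt_claims :: "data \<Rightarrow> claims"

definition jwt_correct :: "jwt_scheme \<Rightarrow> bool" where
  "jwt_correct J \<longleftrightarrow>
     (\<forall>n sk pk C tok. (sk, pk) \<in> set_pmf (jwt_gen J n) \<longrightarrow> tok \<in> set_pmf (jwt_issue J sk C) \<longrightarrow>
        jwt_verify J pk tok \<and> jwt_claims J tok = C)"

record sig_scheme =
  sig_gen :: "nat \<Rightarrow> (data \<times> data) pmf"  (* verification key, signing key *)
  sig_sign :: "data \<Rightarrow> data \<Rightarrow> data pmf"
  sig_verify :: "data \<Rightarrow> data \<Rightarrow> data \<Rightarrow> bool"

record nizk_scheme =
  nizk_gen :: "nat \<Rightarrow> (data \<Rightarrow> data \<Rightarrow> bool) \<Rightarrow> data pmf"
  nizk_prove :: "data \<Rightarrow> data \<Rightarrow> data \<Rightarrow> data pmf"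
  nizk_verify :: "data \<Rightarrow> data \<Rightarrow> data \<Rightarrow> bool"

text \<open>\<open>salt_gen\<close> is the distribution of the users' salts, i.e. of the commitment randomness.\<close>

record setting =
  hash :: "data \<Rightarrow> data"
  salt_gen :: "nat \<Rightarrow> data pmf"
  jwt :: jwt_scheme
  sig :: sig_scheme
  nizk :: nizk_scheme
  issuers :: "data list"


section \<open>Addresses\<close>

definition address :: "setting \<Rightarrow> claims \<Rightarrow> data \<Rightarrow> data" where
  "address Z C salt = hash Z (tup [stid C, aud C, iss C, salt])"

definition hiding_game ::
  "setting \<Rightarrow> (data \<Rightarrow> data itree) \<Rightarrow> (data \<Rightarrow> data itree) \<Rightarrow> nat \<Rightarrow> bool pmf" where
  "hiding_game Z A1 A2 n = do {
     b \<leftarrow> coin;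
     out \<leftarrow> sample (A1 (tup [unary n]));
     let C0 = decode_claims (item 0 out);
     let C1 = decode_claims (item 1 out);
     let st = item 2 out;
     salt \<leftarrow> salt_gen Z n;
     let zkaddr = address Z (if b then C1 else C0) salt;
     b' \<leftarrow> sample (A2 (tup [unary n, st, zkaddr]));
     return_pmf (to_bool b' = b)
   }"

definition hiding_addresses :: "setting \<Rightarrow> bool" where
  "hiding_addresses Z \<longleftrightarrow> (\<forall>A1 A2. ppt A1 \<longrightarrow> ppt A2 \<longrightarrow>
     negligible (\<lambda>n. \<bar>pmf (hiding_game Z A1 A2 n) True - 1/2\<bar>))"


section \<open>OpenID providers and users\<close>

text \<open>Issuer, secret key and public key of each OpenID provider.\<close>

type_synonym providers = "(data \<times> data \<times> data) list"

primrec sample_providers :: "setting \<Rightarrow> nat \<Rightarrow> data list \<Rightarrow> providers pmf" where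
  "sample_providers Z n [] = return_pmf []"
| "sample_providers Z n (i # is) = do {
     (sk, pk) \<leftarrow> jwt_gen (jwt Z) n;
     ops \<leftarrow> sample_providers Z n is;
     return_pmf ((i, sk, pk) # ops)
   }"

definition jwks :: "providers \<Rightarrow> data" where
  "jwks ops = tup (map (\<lambda>(i, sk, pk). tup [i, pk]) ops)"

text \<open>
  The users: the owner of an address of a given issuer is recorded under (issuer, address) with
  stable identifier, application identifier and persistent salt. Registration never changes the
  owner of an existing address.
\<close>

type_synonym accounts = "data \<times> data \<rightharpoonup> data \<times> data \<times> data"

definition register :: "setting \<Rightarrow> claims \<Rightarrow> data \<Rightarrow> accounts \<Rightarrow> accounts" where
  "register Z C salt acc =
     (let k = (iss C, address Z C salt) in
      if acc k = None then acc(k \<mapsto> (stid C, aud C, salt)) else acc)"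

text \<open>A registration request of the adversary has the form \<open>tup [C, salt]\<close>.\<close>

definition register_request :: "setting \<Rightarrow> accounts \<Rightarrow> data \<Rightarrow> accounts" where
  "register_request Z acc q = register Z (decode_claims (item 0 q)) (item 1 q) acc"


section \<open>The scheme\<close>

text \<open>Validity of a key pair means that it is a possible output of key generation.\<close>

definition P_zkLogin :: "setting \<Rightarrow> data \<Rightarrow> data \<Rightarrow> bool" where
  "P_zkLogin Z t w \<longleftrightarrow>
     (let pk_OP = item 0 t; issuer = item 1 t; zkaddr = item 2 t; T = item 3 t;
          tok = item 0 w; salt = item 1 w; r = item 2 w; vk_u = item 3 w; sk_u = item 4 w;
          C = jwt_claims (jwt Z) tok
      in zkaddr = hash Z (tup [stid C, aud C, iss C, salt])
         \<and> iss C = issuer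
         \<and> nonce C = hash Z (tup [vk_u, T, r])
         \<and> jwt_verify (jwt Z) pk_OP tok
         \<and> (\<exists>n. (vk_u, sk_u) \<in> set_pmf (sig_gen (sig Z) n)))"

definition Ckt :: "setting \<Rightarrow> data \<Rightarrow> data \<Rightarrow> bool" where
  "Ckt Z zkx zkw \<longleftrightarrow>
     (let pk_OP = item 0 zkx; issuer = item 1 zkx; zkaddr = item 2 zkx; T = item 3 zkx;
          vk_u = item 4 zkx; tok = item 0 zkw; salt = item 1 zkw; r = item 2 zkw;
          C = jwt_claims (jwt Z) tok
      in zkaddr = hash Z (tup [stid C, aud C, iss C, salt])
         \<and> iss C = issuer
         \<and> nonce C = hash Z (tup [vk_u, T, r])
         \<and> jwt_verify (jwt Z) pk_OP tok)"

definition Sigma_sign :: "setting \<Rightarrow> data \<Rightarrow> data \<Rightarrow> data \<Rightarrow> data \<Rightarrow> data pmf" where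
  "Sigma_sign Z tag pk w M = do {
     let pk_OP = item 0 tag;
     let issuer = item 1 tag;
     let zkaddr = item 2 tag;
     let T = item 3 tag;
     let tok = item 0 w;
     let salt = item 1 w;
     let r = item 2 w;
     let vk_u = item 3 w;
     let sk_u = item 4 w;
     \<sigma>_u \<leftarrow> sig_sign (sig Z) sk_u M;
     let zkx = tup [pk_OP, issuer, zkaddr, T, vk_u];
     let zkw = tup [tok, salt, r];
     \<pi> \<leftarrow> nizk_prove (nizk Z) pk zkx zkw;
     return_pmf (tup [vk_u, T, \<sigma>_u, \<pi>])
   }"

definition Sigma_verify :: "setting \<Rightarrow> data \<Rightarrow> data \<Rightarrow> data \<Rightarrow> data \<Rightarrow> bool" where
  "Sigma_verify Z tag pk M \<sigma> \<longleftrightarrow>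
     (let pk_OP = item 0 tag; issuer = item 1 tag; zkaddr = item 2 tag; T = item 3 tag;
          vk_u = item 0 \<sigma>; \<sigma>_u = item 2 \<sigma>; \<pi> = item 3 \<sigma>;
          zkx = tup [pk_OP, issuer, zkaddr, T, vk_u]
      in item 1 \<sigma> = T \<and> sig_verify (sig Z) vk_u M \<sigma>_u \<and> nizk_verify (nizk Z) pk zkx \<pi>)"

definition Sigma_zkLogin :: "setting \<Rightarrow> tws" where
  "Sigma_zkLogin Z =
     \<lparr>tws_gen = (\<lambda>n. nizk_gen (nizk Z) n (Ckt Z)),
      tws_sign = Sigma_sign Z,
      tws_verify = Sigma_verify Z\<rparr>"

text \<open>Returns the witness and the provider's public key; \<open>None\<close> if the issuer is unknown or nobody
  owns the address.\<close>

definition GetWitness ::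
  "setting \<Rightarrow> nat \<Rightarrow> providers \<Rightarrow> accounts \<Rightarrow> data \<Rightarrow> data \<Rightarrow> data \<Rightarrow> (data \<times> data) pmf option" where
  "GetWitness Z n ops acc issuer zkaddr T_exp =
     (case (map_of ops issuer, acc (issuer, zkaddr)) of
        (Some (sk_OP, pk_OP), Some (stid', aud', salt)) \<Rightarrow> Some (do {
          (vk_u, sk_u) \<leftarrow> sig_gen (sig Z) n;
          r \<leftarrow> bitstring n;
          let nonce' = hash Z (tup [vk_u, T_exp, r]);
          tok \<leftarrow> jwt_issue (jwt Z) sk_OP
                  \<lparr>stid = stid', aud = aud', iss = issuer, nonce = nonce'\<rparr>;
          return_pmf (tup [tok, salt, r, vk_u, sk_u], pk_OP)
        })
      | _ \<Rightarrow> None)"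

definition zkLoginGen :: "setting \<Rightarrow> nat \<Rightarrow> data pmf" where
  "zkLoginGen Z n = tws_gen (Sigma_zkLogin Z) n"

definition zkLoginSign ::
  "setting \<Rightarrow> nat \<Rightarrow> providers \<Rightarrow> accounts \<Rightarrow> data \<Rightarrow> data \<Rightarrow> data \<Rightarrow> data \<Rightarrow> data \<Rightarrow> data pmf option" where
  "zkLoginSign Z n ops acc pk zkaddr issuer M T_exp =
     map_option
       (\<lambda>W. do {
          (w, pk_OP) \<leftarrow> W;
          let tag = tup [pk_OP, issuer, zkaddr, T_exp];
          tws_sign (Sigma_zkLogin Z) tag pk w M
        })
       (GetWitness Z n ops acc issuer zkaddr T_exp)"

definition zkLoginVerify ::
  "setting \<Rightarrow> providers \<Rightarrow> data \<Rightarrow> data \<Rightarrow> data \<Rightarrow> data \<Rightarrow> data \<Rightarrow> data \<Rightarrow> bool" where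
  "zkLoginVerify Z ops pk zkaddr issuer M \<sigma> T_cur \<longleftrightarrow>
     \<not> numeral_value T_cur > numeral_value (item 1 \<sigma>) \<and>
     (case map_of ops issuer of
        None \<Rightarrow> False
      | Some (sk_OP, pk_OP) \<Rightarrow>
          tws_verify (Sigma_zkLogin Z) (tup [pk_OP, issuer, zkaddr, item 1 \<sigma>]) pk M \<sigma>)"

text \<open>
  In the witness hiding experiments for \<open>Sigma_zkLogin\<close>, witnesses are obtained by \<open>GetWitness\<close>,
  for tags carrying the correct key of the issuer.
\<close>

definition zkLogin_env :: "setting \<Rightarrow> (providers \<times> accounts) witness_env" where
  "zkLogin_env Z =
     \<lparr>env_init = (\<lambda>n. do {
        ops \<leftarrow> sample_providers Z n (issuers Z);
        return_pmf ((ops, Map.empty), jwks ops)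
      }),
      env_register = (\<lambda>(ops, acc) q. (ops, register_request Z acc q)),
      env_obtain = (\<lambda>n (ops, acc) t.
        let pk_OP = item 0 t; issuer = item 1 t; zkaddr = item 2 t; T = item 3 t in
        if map_option snd (map_of ops issuer) = Some pk_OP
        then map_option (map_pmf fst) (GetWitness Z n ops acc issuer zkaddr T)
        else None)\<rparr>"


section \<open>Unlinkability\<close>

text \<open>
  Index 0 is for signing queries, of the form \<open>tup [zkaddr, iss, m, T_exp]\<close>; any other index
  registers a user controlled by the adversary. The flag records a violation of the rules of the
  game: a signing query for which no witness can be obtained, or the registration of a user
  having the claims of \<open>C0\<close> or \<open>C1\<close>, whose users have to be honest.
\<close>

definition identity :: "claims \<Rightarrow> data \<times> data \<times> data" where
  "identity C = (stid C, aud C, iss C)"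

definition UL_oracle ::
  "setting \<Rightarrow> nat \<Rightarrow> providers \<Rightarrow> data \<Rightarrow> claims \<Rightarrow> claims \<Rightarrow> (accounts \<times> bool) responder" where
  "UL_oracle Z n ops pk C0 C1 = (\<lambda>(acc, bad) i q.
     if i = 0 then
       (case zkLoginSign Z n ops acc pk (item 0 q) (item 1 q) (item 2 q) (item 3 q) of
          None \<Rightarrow> return_pmf (Leaf, (acc, True))
        | Some S \<Rightarrow> do {
            \<sigma> \<leftarrow> S;
            return_pmf (\<sigma>, (acc, bad))
          })
     else
       return_pmf (Leaf,
         (register_request Z acc q,
          bad \<or> identity (decode_claims (item 0 q)) \<in> {identity C0, identity C1})))"

text \<open>The second component of the outcome is the final value of the flag.\<close>

definition UL_game ::
  "setting \<Rightarrow> (data \<Rightarrow> data itree) \<Rightarrow> (data \<Rightarrow> data itree) \<Rightarrow> nat \<Rightarrow> (bool \<times> bool) pmf" where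
  "UL_game Z A1 A2 n = do {
     ops \<leftarrow> sample_providers Z n (issuers Z);
     pk \<leftarrow> zkLoginGen Z n;
     b \<leftarrow> coin;
     out \<leftarrow> sample (A1 (tup [unary n, pk, jwks ops]));
     let C0 = decode_claims (item 0 out);
     let C1 = decode_claims (item 1 out);
     let st = item 2 out;
     if iss C0 \<noteq> iss C1 then return_pmf (b, False)
     else do {
       let Cb = (if b then C1 else C0);
       salt \<leftarrow> salt_gen Z n;
       let zkaddr = address Z Cb salt;
       (b', (acc, bad)) \<leftarrow> run (UL_oracle Z n ops pk C0 C1) (A2 (tup [unary n, st, zkaddr]))
                              (register Z Cb salt Map.empty, False);
       return_pmf (to_bool b' = b, bad)
     }
   }"

definition unlinkable :: "setting \<Rightarrow> bool" where
  "unlinkable Z \<longleftrightarrow>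
     (\<forall>A1 A2. ppt A1 \<longrightarrow> ppt A2 \<longrightarrow> (\<forall>n. \<forall>(out, bad) \<in> set_pmf (UL_game Z A1 A2 n). \<not> bad) \<longrightarrow>
        negligible (\<lambda>n. \<bar>pmf (map_pmf fst (UL_game Z A1 A2 n)) True - 1/2\<bar>))"

end

theory Submission
  imports Defs
begin

text \<open>
  An adversary against unlinkability is run by an adversary against witness hiding, which plays
  the challenger itself: it tosses \<open>b\<close>, draws the salt of the challenge address, registers its
  owner and forwards signing queries after completing the tag with the issuer's public key. The
  real experiment is then the unlinkability game, so by witness hiding the signatures may be
  simulated. With simulated signatures the salt is used for the challenge address only, and the
  game becomes the hiding game of the address commitment, played by an adversary that samples the
  providers and runs the simulator on its own.

  Both reductions run a program with its oracle queries answered by other programs. That this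
  stays in polynomial time is a program transformation: queries become subroutine calls.
\<close>

section \<open>Oracle substitution in programs\<close>

text \<open>The obstacle to composing programs is that a query is charged for its argument, while an
  answer of any size is received for free. The output of a polynomial-time program with oracles thus
  has no polynomial bound, and handing it to a further program may cost too much. Every subroutine
  whose result is kept is therefore run with its oracles closed (\<open>silence\<close>), which
  leaves \<open>sample\<close> unchanged. Results obtained with open oracles are only tested,
  discarded, or passed to \<open>A2\<close> as answers, and the time bound of \<open>A2\<close>
  holds for all answers.

  A second point is legality. Witness hiding covers only adversaries that never raise the flag, so
  the reduction has to inherit this from the given adversary. The flag of the game also records
  forbidden registrations, which the witness hiding experiment does not know; hence the two are
  compared by a coupling with equal outputs and an implication between the flags.\<close>

lemma bind_itree_Ret [simp]: "bind_itree t Ret = t"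
  by (induction t) auto

lemma bind_itree_assoc: "bind_itree (bind_itree t f) g = bind_itree t (\<lambda>a. bind_itree (f a) g)"
  by (induction t) auto

lemma map_itree_conv_bind: "map_itree f t = bind_itree t (\<lambda>a. Ret (f a))"
  by (induction t) auto

lemma map_itree_bind: "map_itree g (bind_itree t f) = bind_itree t (\<lambda>a. map_itree g (f a))"
  by (simp add: map_itree_conv_bind bind_itree_assoc)

lemma bind_map_itree: "bind_itree (map_itree g t) f = bind_itree t (\<lambda>a. f (g a))"
  by (simp add: map_itree_conv_bind bind_itree_assoc)

lemma set_bind_itree: "set_itree (bind_itree t f) = (\<Union>a\<in>set_itree t. set_itree (f a))"
  by (induction t) auto

text \<open>An effect handler: queries made by \<open>h i q\<close> itself stay open, so a handler
  may in turn use the oracles of an outer experiment.\<close>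

primrec subst_itree :: "(nat \<Rightarrow> data \<Rightarrow> data itree) \<Rightarrow> 'a itree \<Rightarrow> 'a itree" where
  "subst_itree h (Ret a) = Ret a"
| "subst_itree h (Coin k) = Coin (\<lambda>b. subst_itree h (k b))"
| "subst_itree h (Ask i q k) = bind_itree (h i q) (\<lambda>a. subst_itree h (k a))"

lemma subst_bind_itree:
  "subst_itree h (bind_itree t f) = bind_itree (subst_itree h t) (\<lambda>a. subst_itree h (f a))"
  by (induction t) (auto simp: bind_itree_assoc)

lemma subst_map_itree: "subst_itree h (map_itree f t) = map_itree f (subst_itree h t)"
  by (simp add: map_itree_conv_bind subst_bind_itree)

lemma subst_itree_Ask [simp]: "subst_itree (\<lambda>i q. Ask i q Ret) t = t"
  by (induction t) auto

text \<open>The results below an \<open>Ask\<close> node range over all answers, and a handler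
  merely selects some of them. Facts shown for every answer thus carry over to substituted
  runs.\<close>

lemma set_subst_itree: "set_itree (subst_itree h t) \<subseteq> set_itree t"
proof (induction t)
  case (Coin k)
  then show ?case by fastforce
next
  case (Ask i q k)
  then show ?case by (fastforce simp: set_bind_itree)
qed simp

abbreviation silence :: "'a itree \<Rightarrow> 'a itree" where
  "silence \<equiv> subst_itree (\<lambda>_ _. Ret Leaf)"

section \<open>Variables, sizes and time in a single execution\<close>

lemma exec_mono: "exec c s t m \<Longrightarrow> m \<le> n \<Longrightarrow> exec c s t n"
proof (induction arbitrary: n rule: exec.induct)
  case (Seq c1 s t m c2 f k)
  have "exec (Seq c1 c2) s (bind_itree t f) (m + (n - m))"
    using Seq by (intro exec.Seq) auto
  then show ?case using Seq.prems by simp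
next
  case (If_True e s c1 t m c2)
  have "exec (If e c1 c2) s t (cost e s + 1 + (n - (cost e s + 1)))"
    using If_True by (intro exec.If_True) auto
  then show ?case using If_True.prems by simp
next
  case (If_False e s c2 t m c1)
  have "exec (If e c1 c2) s t (cost e s + 1 + (n - (cost e s + 1)))"
    using If_False by (intro exec.If_False) auto
  then show ?case using If_False.prems by simp
next
  case (While_True e s c t m f k)
  have "exec (While e c) s (bind_itree t f) (cost e s + 1 + m + (n - (cost e s + 1 + m)))"
    using While_True by (intro exec.While_True) auto
  then show ?case using While_True.prems by simp
qed (auto intro: exec.intros)

text \<open>Variables that are only read do not count: they keep their initial value, which is
  \<open>Leaf\<close> except for the input.\<close>

primrec top_var :: "cmd \<Rightarrow> nat" where
  "top_var (Assign x e) = Suc x"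
| "top_var (Toss x) = Suc x"
| "top_var (Query x i e) = Suc x"
| "top_var (Seq c1 c2) = max (top_var c1) (top_var c2)"
| "top_var (If e c1 c2) = max (top_var c1) (top_var c2)"
| "top_var (While e c) = top_var c"

lemma exec_untouched:
  "exec c s t n \<Longrightarrow> r \<in> set_itree t \<Longrightarrow> top_var c \<le> v \<Longrightarrow> r v = s v"
proof (induction arbitrary: r rule: exec.induct)
  case (Seq c1 s t m c2 f n)
  then obtain s' where s': "s' \<in> set_itree t" "r \<in> set_itree (f s')"
    by (auto simp: set_bind_itree)
  then show ?case using Seq.IH(1)[OF s'(1)] Seq.IH(2)[OF s'] Seq.prems by simp
next
  case (While_True e s c t m f n)
  then obtain s' where s': "s' \<in> set_itree t" "r \<in> set_itree (f s')"
    by (auto simp: set_bind_itree)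
  then show ?case using While_True.IH(1)[OF s'(1)] While_True.IH(2)[OF s'] While_True.prems by simp
qed auto

text \<open>Variables and projections only point into existing data; whatever else an expression
  produces is paid for in its cost.\<close>

lemma size_eval_le: "size (eval e s) \<le> max M (cost e s)" if "\<And>v. size (s v) \<le> M"
proof (induction e)
  case (Left e)
  then show ?case by (cases "eval e s") auto
next
  case (Right e)
  then show ?case by (cases "eval e s") auto
qed (use that in \<open>auto simp: bit_def le_max_iff_disj\<close>)

text \<open>Receiving the answer of an oracle costs nothing, so only silenced executions have outputs of bounded size.\<close>

lemma exec_size:
  "exec c s t n \<Longrightarrow> \<forall>v. size (s v) \<le> M \<Longrightarrow> n \<le> M \<Longrightarrow> r \<in> set_itree (silence t) \<Longrightarrow>
    \<forall>v. size (r v) \<le> M"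
proof (induction arbitrary: r rule: exec.induct)
  case (Assign e s n x)
  then have "size (eval e s) \<le> M"
    using size_eval_le[of s M e] by simp
  then show ?case using Assign by simp
next
  case (Seq c1 s t m c2 f n)
  then obtain s' where s': "s' \<in> set_itree (silence t)" "r \<in> set_itree (silence (f s'))"
    by (auto simp: subst_bind_itree set_bind_itree)
  then have "s' \<in> set_itree t" "\<forall>v. size (s' v) \<le> M"
    using subsetD[OF set_subst_itree s'(1)] Seq.IH(1)[of s'] Seq.prems s' by auto
  then show ?case using Seq.IH(2)[of s' r] Seq.prems s' by simp
next
  case (While_True e s c t m f n)
  then obtain s' where s': "s' \<in> set_itree (silence t)" "r \<in> set_itree (silence (f s'))"
    by (auto simp: subst_bind_itree set_bind_itree)
  then have "s' \<in> set_itree t" "\<forall>v. size (s' v) \<le> M"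
    using subsetD[OF set_subst_itree s'(1)] While_True.IH(1)[of s'] While_True.prems s' by auto
  then show ?case using While_True.IH(2)[of s' r] While_True.prems s' by simp
next
  case (Toss n x s)
  then show ?case by (auto simp: bit_def)
qed simp_all

section \<open>Moving a program to other variables and replacing its queries by code\<close>

primrec shift_expr :: "nat \<Rightarrow> expr \<Rightarrow> expr" where
  "shift_expr k (Const d) = Const d"
| "shift_expr k (Var x) = Var (k + x)"
| "shift_expr k (Mk e1 e2) = Mk (shift_expr k e1) (shift_expr k e2)"
| "shift_expr k (Left e) = Left (shift_expr k e)"
| "shift_expr k (Right e) = Right (shift_expr k e)"
| "shift_expr k (Equal e1 e2) = Equal (shift_expr k e1) (shift_expr k e2)"

primrec translate :: "nat \<Rightarrow> (nat \<Rightarrow> nat \<Rightarrow> expr \<Rightarrow> cmd) \<Rightarrow> cmd \<Rightarrow> cmd" where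
  "translate k H (Assign x e) = Assign (k + x) (shift_expr k e)"
| "translate k H (Toss x) = Toss (k + x)"
| "translate k H (Query x i e) = H i (k + x) (shift_expr k e)"
| "translate k H (Seq c1 c2) = Seq (translate k H c1) (translate k H c2)"
| "translate k H (If e c1 c2) = If (shift_expr k e) (translate k H c1) (translate k H c2)"
| "translate k H (While e c) = While (shift_expr k e) (translate k H c)"

text \<open>The part below \<open>k\<close> is a frame that the moved program itself does not touch
  but that the code answering its queries may read.\<close>

definition overlay :: "nat \<Rightarrow> store \<Rightarrow> store \<Rightarrow> store" where
  "overlay k ctx s = (\<lambda>v. if v < k then ctx v else s (v - k))"

definition upper_store :: "nat \<Rightarrow> store \<Rightarrow> store" where
  "upper_store k u = (\<lambda>v. u (k + v))"

lemma upper_store_overlay [simp]: "upper_store k (overlay k ctx s) = s"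
  by (simp add: overlay_def upper_store_def)

lemma eval_shift [simp]: "eval (shift_expr k e) (overlay k ctx s) = eval e s"
  by (induction e) (auto simp: overlay_def)

lemma cost_shift [simp]: "cost (shift_expr k e) (overlay k ctx s) = cost e s"
  by (induction e) auto

lemma overlay_upd [simp]: "(overlay k ctx s)(k + x := a) = overlay k ctx (s(x := a))"
  by (auto simp: overlay_def fun_eq_iff)

text \<open>The rules for \<open>Seq\<close> and \<open>While\<close> want a continuation that takes
  the whole store, so the inner store is read back by \<open>upper_store\<close>.\<close>

lemma map_overlay_bind_subst:
  "map_itree (overlay k ctx) (subst_itree h (bind_itree t f)) =
   bind_itree (map_itree (overlay k ctx) (subst_itree h t))
     (\<lambda>u. map_itree (overlay k ctx) (subst_itree h (f (upper_store k u))))"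
  by (simp add: subst_bind_itree map_itree_bind bind_map_itree)

text \<open>A query takes at least one unit of time beyond evaluating its argument, so an overhead
  of \<open>w\<close> per query multiplies the time by at most \<open>Suc w\<close>. The charge for
  queries also keeps their size below the running time, so handlers need to be fast only up to size
  \<open>M\<close>. Variables from \<open>N\<close> on remain \<open>Leaf\<close>, which gives the
  handlers clean scratch space.\<close>

lemma exec_translate:
  assumes handler: "\<And>i x e s. x < N \<Longrightarrow> (\<forall>v\<ge>N. s v = Leaf) \<Longrightarrow> size (eval e s) \<le> M \<Longrightarrow>
    exec (H i (k + x) (shift_expr k e)) (overlay k ctx s)
      (map_itree (\<lambda>a. overlay k ctx (s(x := a))) (h i (eval e s))) (cost e s + w)"
  shows "exec c s t n \<Longrightarrow> top_var c \<le> N \<Longrightarrow> \<forall>v\<ge>N. s v = Leaf \<Longrightarrow> n \<le> M \<Longrightarrow>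
    exec (translate k H c) (overlay k ctx s) (map_itree (overlay k ctx) (subst_itree h t)) (n * Suc w)"
proof (induction rule: exec.induct)
  case (Assign e s n x)
  have "cost e s < n * Suc w" using Assign by (simp add: trans_less_add1)
  then show ?case using exec.Assign[of "shift_expr k e" "overlay k ctx s" "n * Suc w" "k + x"] by simp
next
  case (Toss n x s)
  then show ?case using exec.Toss[of "n * Suc w" "k + x" "overlay k ctx s"] by (simp add: comp_def)
next
  case (Query e s n x i)
  have "exec (H i (k + x) (shift_expr k e)) (overlay k ctx s)
      (map_itree (\<lambda>a. overlay k ctx (s(x := a))) (h i (eval e s))) (cost e s + w)"
    using Query by (intro handler) auto
  moreover have "cost e s + w \<le> n * Suc w"
    using Query by (cases n) auto
  ultimately have "exec (H i (k + x) (shift_expr k e)) (overlay k ctx s)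
      (map_itree (\<lambda>a. overlay k ctx (s(x := a))) (h i (eval e s))) (n * Suc w)"
    by (rule exec_mono)
  then show ?case
    by (simp add: map_itree_conv_bind bind_itree_assoc)
next
  case (Seq c1 s t m c2 f n)
  have "exec (Seq (translate k H c1) (translate k H c2)) (overlay k ctx s)
    (map_itree (overlay k ctx) (subst_itree h (bind_itree t f))) (m * Suc w + n * Suc w)"
    unfolding map_overlay_bind_subst
  proof (rule exec.Seq)
    show "exec (translate k H c1) (overlay k ctx s) (map_itree (overlay k ctx) (subst_itree h t)) (m * Suc w)"
      using Seq by simp
    fix u assume "u \<in> set_itree (map_itree (overlay k ctx) (subst_itree h t))"
    then obtain s' where s': "s' \<in> set_itree t" "u = overlay k ctx s'"
      using set_subst_itree by (fastforce simp: itree.set_map)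
    have "\<forall>v\<ge>N. s' v = Leaf"
      using exec_untouched[OF Seq.hyps(1) s'(1)] Seq.prems by auto
    then show "exec (translate k H c2) u
        (map_itree (overlay k ctx) (subst_itree h (f (upper_store k u)))) (n * Suc w)"
      using Seq s' by simp
  qed
  then show ?case by (simp add: algebra_simps)
next
  case (If_True e s c1 t n c2)
  have "exec (translate k H (If e c1 c2)) (overlay k ctx s) (map_itree (overlay k ctx) (subst_itree h t))
      (cost e s + 1 + n * Suc w)"
    using exec.If_True[of "shift_expr k e" "overlay k ctx s"] If_True by simp
  then show ?case by (rule exec_mono) (simp add: algebra_simps)
next
  case (If_False e s c2 t n c1)
  have "exec (translate k H (If e c1 c2)) (overlay k ctx s) (map_itree (overlay k ctx) (subst_itree h t))
      (cost e s + 1 + n * Suc w)"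
    using exec.If_False[of "shift_expr k e" "overlay k ctx s"] If_False by simp
  then show ?case by (rule exec_mono) (simp add: algebra_simps)
next
  case (While_False e s n c)
  have "cost e s < n * Suc w" using While_False by (simp add: trans_less_add1)
  then show ?case
    using exec.While_False[of "shift_expr k e" "overlay k ctx s" "n * Suc w"] While_False by simp
next
  case (While_True e s c t m f n)
  have "exec (While (shift_expr k e) (translate k H c)) (overlay k ctx s)
    (map_itree (overlay k ctx) (subst_itree h (bind_itree t f)))
    (cost (shift_expr k e) (overlay k ctx s) + 1 + m * Suc w + n * Suc w)"
    unfolding map_overlay_bind_subst
  proof (rule exec.While_True)
    show "to_bool (eval (shift_expr k e) (overlay k ctx s))"
      using While_True by simp
    show "exec (translate k H c) (overlay k ctx s) (map_itree (overlay k ctx) (subst_itree h t)) (m * Suc w)"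
      using While_True by simp
    fix u assume "u \<in> set_itree (map_itree (overlay k ctx) (subst_itree h t))"
    then obtain s' where s': "s' \<in> set_itree t" "u = overlay k ctx s'"
      using set_subst_itree by (fastforce simp: itree.set_map)
    have "\<forall>v\<ge>N. s' v = Leaf"
      using exec_untouched[OF While_True.hyps(2) s'(1)] While_True.prems by auto
    then show "exec (While (shift_expr k e) (translate k H c)) u
        (map_itree (overlay k ctx) (subst_itree h (f (upper_store k u)))) (n * Suc w)"
      using While_True s' by simp
  qed
  then show ?case by (auto intro: exec_mono simp: algebra_simps)
qed

section \<open>Closure properties of polynomial time\<close>

lemma poly_mono_nat: "a \<le> b \<Longrightarrow> poly p a \<le> poly p b" for p :: "nat poly"
  by (induction p) (auto intro!: add_mono mult_mono)

lemma exec_SeqI: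
  assumes "exec c1 s t m" "\<And>s'. s' \<in> set_itree t \<Longrightarrow> exec c2 s' (f s') n"
    and "t' = bind_itree t f" "m + n \<le> N"
  shows "exec (Seq c1 c2) s t' N"
  using exec_mono[OF exec.Seq[OF assms(1,2)] assms(4)] assms(3) by simp

lemma exec_AssignI: "v = eval e s \<Longrightarrow> cost e s < n \<Longrightarrow> exec (Assign x e) s (Ret (s(x := v))) n"
  by (simp add: exec.Assign)

text \<open>There is no empty command, so the base case already resets \<open>k\<close>; this
  explains the disjunct \<open>v = k\<close> in the resulting store.\<close>

primrec clear :: "nat \<Rightarrow> nat \<Rightarrow> cmd" where
  "clear k 0 = Assign k (Const Leaf)"
| "clear k (Suc m) = Seq (clear k m) (Assign (k + m) (Const Leaf))"

lemma exec_clear: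
  "exec (clear k m) s (Ret (\<lambda>v. if v = k \<or> k \<le> v \<and> v < k + m then Leaf else s v)) (2 + 2 * m)"
proof (induction m)
  case 0
  have "exec (clear k 0) s (Ret (s(k := eval (Const Leaf) s))) 2"
    unfolding clear.simps by (rule exec.Assign) simp
  also have "s(k := eval (Const Leaf) s) = (\<lambda>v. if v = k \<or> k \<le> v \<and> v < k + 0 then Leaf else s v)"
    by auto
  finally show ?case by simp
next
  case (Suc m)
  show ?case unfolding clear.simps
    by (rule exec_SeqI[OF Suc, where n = 2 and f = "\<lambda>s. Ret (s(k + m := eval (Const Leaf) s))"])
      (auto intro!: exec_AssignI)
qed

text \<open>A program computing \<open>A\<close> can be used like an assignment by other programs, with the variables
  from \<open>k\<close> on as scratch space that is clean before and after.\<close>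

lemma ppt_call:
  assumes "ppt A"
  obtains p where "\<And>k y e. y < k \<Longrightarrow> \<exists>c. \<forall>s. (\<forall>z\<ge>k. s z = Leaf) \<longrightarrow>
    exec c s (map_itree (\<lambda>a. s(y := a)) (A (eval e s))) (cost e s + poly p (size (eval e s)))"
proof -
  from assms obtain c0 p0 where c0: "\<And>x. \<exists>t.
     exec c0 ((\<lambda>_. Leaf)(0 := x)) t (poly p0 (size x)) \<and> A x = map_itree (\<lambda>s. s 0) t"
    unfolding ppt_def by metis
  define N where "N = Suc (top_var c0)"
  \<comment> \<open>With \<open>n\<close> the time of \<open>c0\<close>, re-issuing a query of size
    at most \<open>n\<close> costs at most \<open>Suc n\<close> beyond its argument, whence
    \<open>n * (n + 2)\<close>. The constant pays for copying input and output and for clearing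
    \<open>N\<close> variables.\<close>
  define p where "p = p0 * (p0 + 2) + [:6 + 2 * N:]"
  show thesis
  proof (rule that[of p], intro exI allI impI)
    fix k y :: nat and e s
    assume y: "y < k" and clean: "\<forall>z\<ge>k. s z = Leaf"
    define x where "x = eval e s"
    define n where "n = poly p0 (size x)"
    obtain t where t: "exec c0 ((\<lambda>_. Leaf)(0 := x)) t n" and A: "A x = map_itree (\<lambda>s. s 0) t"
      using c0 n_def by blast
    \<comment> \<open>Each query is its own handler: the program only changes its variables and its
      oracles stay open.\<close>
    define H where "H = (\<lambda>i x e. Query x i e)"
    have "exec (translate k H c0) (overlay k s ((\<lambda>_. Leaf)(0 := x)))
        (map_itree (overlay k s) (subst_itree (\<lambda>i q. Ask i q Ret) t)) (n * Suc (Suc n))"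
    proof (rule exec_translate[where N = N and M = n])
      fix i x e s'
      assume "size (eval e s') \<le> n"
      then show "exec (H i (k + x) (shift_expr k e)) (overlay k s s')
        (map_itree (\<lambda>a. overlay k s (s'(x := a))) (Ask i (eval e s') Ret)) (cost e s' + Suc n)"
        using exec.Query[of "shift_expr k e" "overlay k s s'" "cost e s' + Suc n" "k + x" i]
        by (simp add: H_def comp_def)
    qed (use t in \<open>auto simp: N_def\<close>)
    moreover have "overlay k s ((\<lambda>_. Leaf)(0 := x)) = s(k := x)"
      using clean by (auto simp: overlay_def)
    ultimately have run: "exec (translate k H c0) (s(k := x)) (map_itree (overlay k s) t) (n * (n + 2))"
      by simp
    have t0: "r v = Leaf" if "r \<in> set_itree t" "v \<ge> N" for r v
      using exec_untouched[OF t that(1), of v] that(2) by (auto simp: N_def)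
    let ?c = "Seq (Assign k e) (Seq (translate k (\<lambda>i x e. Query x i e) c0)
      (Seq (Assign y (Var k)) (clear k N)))"
    have "exec ?c s (map_itree (\<lambda>a. s(y := a)) (A x)) (cost e s + poly p (size x))"
    proof (rule exec_SeqI)
      show "exec (Assign k e) s (Ret (s(k := x))) (cost e s + 1)"
        using exec.Assign[of e s "cost e s + 1" k] by (simp add: x_def)
      fix s' assume "s' \<in> set_itree (Ret (s(k := x)))"
      then have s': "s' = s(k := x)" by simp
      show "exec (Seq (translate k (\<lambda>i x e. Query x i e) c0) (Seq (Assign y (Var k)) (clear k N))) s'
          (map_itree (\<lambda>a. s(y := a)) (A x)) (n * (n + 2) + (2 + (2 + 2 * N)))"
        unfolding s'
      proof (rule exec_SeqI[OF run[unfolded H_def]])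
        fix u assume "u \<in> set_itree (map_itree (overlay k s) t)"
        then obtain r where r: "r \<in> set_itree t" "u = overlay k s r" by (auto simp: itree.set_map)
        show "exec (Seq (Assign y (Var k)) (clear k N)) u (Ret (s(y := u k))) (2 + (2 + 2 * N))"
        proof (rule exec_SeqI)
          show "exec (Assign y (Var k)) u (Ret (u(y := u k))) 2"
            using exec.Assign[of "Var k" u 2 y] by simp
          fix u' assume "u' \<in> set_itree (Ret (u(y := u k)))"
          then have u': "u' = u(y := u k)" by simp
          have "(\<lambda>v. if v = k \<or> k \<le> v \<and> v < k + N then Leaf else u' v) = s(y := u k)"
            using y clean t0[OF r(1)] by (auto simp: u' r(2) overlay_def fun_eq_iff)
          then show "exec (clear k N) u' (Ret (s(y := u k))) (2 + 2 * N)"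
            using exec_clear[of k N u'] by simp
        qed auto
      next
        show "map_itree (\<lambda>a. s(y := a)) (A x) =
            bind_itree (map_itree (overlay k s) t) (\<lambda>u. Ret (s(y := u k)))"
          by (simp add: A map_itree_conv_bind bind_itree_assoc overlay_def)
      qed simp
    qed (auto simp: p_def n_def algebra_simps)
    then show "exec ?c s (map_itree (\<lambda>a. s(y := a)) (A (eval e s))) (cost e s + poly p (size (eval e s)))"
      by (simp add: x_def)
  qed
qed

lemma pptI:
  assumes "\<And>x. exec c ((\<lambda>_. Leaf)(0 := x)) (t x) (poly p (size x))"
    and "\<And>x. A x = map_itree (\<lambda>s. s 0) (t x)"
  shows "ppt A"
  using assms unfolding ppt_def by blast

text \<open>What a continuation needs in order to run in polynomial time on the result. It is kept
  apart from \<open>ppt\<close> because a program may output an oracle answer of any size.\<close>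

definition small :: "(data \<Rightarrow> data itree) \<Rightarrow> bool" where
  "small A \<longleftrightarrow> (\<exists>p :: nat poly. \<forall>x. \<forall>y\<in>set_itree (A x). size y \<le> poly p (size x))"

lemma small_silence:
  assumes "ppt A"
  shows "small (\<lambda>x. silence (A x))"
proof -
  from assms obtain c p where c: "\<And>x. \<exists>t.
     exec c ((\<lambda>_. Leaf)(0 := x)) t (poly p (size x)) \<and> A x = map_itree (\<lambda>s. s 0) t"
    unfolding ppt_def by metis
  \<comment> \<open>The bound has to cover the initial store, hence the input, as well as everything
    built within the time limit.\<close>
  have "size y \<le> poly (p + [:0, 1:]) (size x)" if y: "y \<in> set_itree (silence (A x))" for x y
  proof -
    obtain t where t: "exec c ((\<lambda>_. Leaf)(0 := x)) t (poly p (size x))" "A x = map_itree (\<lambda>s. s 0) t"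
      using c by blast
    obtain r where "r \<in> set_itree (silence t)" "y = r 0"
      using y by (auto simp: t(2) subst_map_itree itree.set_map)
    then show ?thesis
      using exec_size[OF t(1), of "poly p (size x) + size x" r] by simp
  qed
  then show ?thesis unfolding small_def by blast
qed

text \<open>The glue of the reductions: projections, pairings and comparisons, each a single
  expression. The size of the result is bounded separately because a large variable is read at cost
  1, whereas a pairing around it is charged in full.\<close>

definition expr_fun :: "(data \<Rightarrow> data) \<Rightarrow> bool" where
  "expr_fun f \<longleftrightarrow> (\<exists>e K. \<forall>s. eval e s = f (s 0) \<and> cost e s \<le> K * Suc (size (s 0)) \<and>
     size (f (s 0)) \<le> K * Suc (size (s 0)))"

lemma size_left: "size (left d) \<le> size d" and size_right: "size (right d) \<le> size d"
  by (cases d; simp)+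

lemma expr_fun_const: "expr_fun (\<lambda>_. d)"
  unfolding expr_fun_def by (intro exI[of _ "Const d"] exI[of _ "1 + size d"]) simp

lemma expr_fun_id: "expr_fun (\<lambda>x. x)"
  unfolding expr_fun_def by (intro exI[of _ "Var 0"] exI[of _ "1"]) simp

lemma expr_fun_Node:
  assumes "expr_fun f" "expr_fun g" shows "expr_fun (\<lambda>x. Node (f x) (g x))"
proof -
  from assms obtain e K e' K' where
    e: "\<And>s. eval e s = f (s 0) \<and> cost e s \<le> K * Suc (size (s 0)) \<and> size (f (s 0)) \<le> K * Suc (size (s 0))" and
    e': "\<And>s. eval e' s = g (s 0) \<and> cost e' s \<le> K' * Suc (size (s 0)) \<and> size (g (s 0)) \<le> K' * Suc (size (s 0))"
    unfolding expr_fun_def by metis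
  show ?thesis unfolding expr_fun_def
  proof (rule exI[of _ "Mk e e'"], rule exI[of _ "2 * K + 2 * K' + 2"], intro allI)
    fix s
    show "eval (Mk e e') s = Node (f (s 0)) (g (s 0)) \<and>
         cost (Mk e e') s \<le> (2 * K + 2 * K' + 2) * Suc (size (s 0)) \<and>
         size (Node (f (s 0)) (g (s 0))) \<le> (2 * K + 2 * K' + 2) * Suc (size (s 0))"
      using e[of s] e'[of s] by (auto simp: algebra_simps)
  qed
qed

lemma expr_fun_left:
  assumes "expr_fun f" shows "expr_fun (\<lambda>x. left (f x))"
proof -
  from assms obtain e K where
    e: "\<And>s. eval e s = f (s 0) \<and> cost e s \<le> K * Suc (size (s 0)) \<and> size (f (s 0)) \<le> K * Suc (size (s 0))"
    unfolding expr_fun_def by metis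
  show ?thesis unfolding expr_fun_def
  proof (rule exI[of _ "Left e"], rule exI[of _ "K + 1"], intro allI)
    fix s
    show "eval (Left e) s = left (f (s 0)) \<and>
         cost (Left e) s \<le> (K + 1) * Suc (size (s 0)) \<and> size (left (f (s 0))) \<le> (K + 1) * Suc (size (s 0))"
      using e[of s] size_left[of "f (s 0)"] by (auto simp: algebra_simps)
  qed
qed

lemma expr_fun_right:
  assumes "expr_fun f" shows "expr_fun (\<lambda>x. right (f x))"
proof -
  from assms obtain e K where
    e: "\<And>s. eval e s = f (s 0) \<and> cost e s \<le> K * Suc (size (s 0)) \<and> size (f (s 0)) \<le> K * Suc (size (s 0))"
    unfolding expr_fun_def by metis
  show ?thesis unfolding expr_fun_def
  proof (rule exI[of _ "Right e"], rule exI[of _ "K + 1"], intro allI)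
    fix s
    show "eval (Right e) s = right (f (s 0)) \<and>
         cost (Right e) s \<le> (K + 1) * Suc (size (s 0)) \<and> size (right (f (s 0))) \<le> (K + 1) * Suc (size (s 0))"
      using e[of s] size_right[of "f (s 0)"] by (auto simp: algebra_simps)
  qed
qed

lemma expr_fun_equal:
  assumes "expr_fun f" "expr_fun g" shows "expr_fun (\<lambda>x. bit (f x = g x))"
proof -
  from assms obtain e K e' K' where
    e: "\<And>s. eval e s = f (s 0) \<and> cost e s \<le> K * Suc (size (s 0)) \<and> size (f (s 0)) \<le> K * Suc (size (s 0))" and
    e': "\<And>s. eval e' s = g (s 0) \<and> cost e' s \<le> K' * Suc (size (s 0)) \<and> size (g (s 0)) \<le> K' * Suc (size (s 0))"
    unfolding expr_fun_def by metis
  show ?thesis unfolding expr_fun_def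
  proof (rule exI[of _ "Equal e e'"], rule exI[of _ "2 * K + K' + 1"], intro allI)
    fix s
    show "eval (Equal e e') s = bit (f (s 0) = g (s 0)) \<and>
         cost (Equal e e') s \<le> (2 * K + K' + 1) * Suc (size (s 0)) \<and>
         size (bit (f (s 0) = g (s 0))) \<le> (2 * K + K' + 1) * Suc (size (s 0))"
      using e[of s] e'[of s] by (auto simp: algebra_simps min_def bit_def)
  qed
qed

lemma expr_fun_item:
  assumes "expr_fun f" shows "expr_fun (\<lambda>x. item i (f x))"
proof -
  have "expr_fun (\<lambda>x. (right ^^ i) (f x))" using assms by (induction i) (auto intro: expr_fun_left expr_fun_right)
  then show ?thesis unfolding item_def by (rule expr_fun_left)
qed

lemmas expr_fun_intros =
  expr_fun_const expr_fun_id expr_fun_Node expr_fun_left expr_fun_right expr_fun_equal expr_fun_item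

lemma tup_simps [simp]: "tup [] = Leaf" "tup (x # xs) = Node x (tup xs)"
  by (simp_all add: tup_def)

section \<open>Sequencing, branching and answering queries in polynomial time\<close>

lemma ppt_Ret:
  assumes "expr_fun f" shows "ppt (\<lambda>x. Ret (f x))"
proof -
  from assms obtain e K where
    e: "\<And>s. eval e s = f (s 0) \<and> cost e s \<le> K * Suc (size (s 0))"
    unfolding expr_fun_def by metis
  show ?thesis
  proof (rule pptI)
    fix x
    let ?s = "(\<lambda>_. Leaf)(0 := x)"
    show "exec (Assign 0 e) ?s (Ret (?s(0 := eval e ?s))) (poly [:K + 1, K:] (size x))"
      by (rule exec.Assign) (use e[of ?s] in \<open>simp add: mult.commute\<close>)
    show "Ret (f x) = map_itree (\<lambda>s. s 0) (Ret (?s(0 := eval e ?s)))"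
      using e[of ?s] by simp
  qed
qed

lemma small_Ret:
  assumes "expr_fun f" shows "small (\<lambda>x. Ret (f x))"
proof -
  from assms obtain K where K: "\<And>s::store. size (f (s 0)) \<le> K * Suc (size (s 0))"
    unfolding expr_fun_def by metis
  show ?thesis unfolding small_def
    by (rule exI[of _ "[:K, K:]"]) (use K[of "\<lambda>_. x" for x] in \<open>auto simp: algebra_simps\<close>)
qed

lemma ppt_coin: "ppt (\<lambda>x. Coin (\<lambda>b. Ret (bit b)))"
proof (rule pptI)
  fix x
  let ?s = "(\<lambda>_. Leaf)(0 := x)"
  show "exec (Toss 0) ?s (Coin (\<lambda>b. Ret (?s(0 := bit b)))) (poly 1 (size x))"
    by (rule exec.Toss) simp
qed (simp add: comp_def)

lemma small_coin: "small (\<lambda>x. Coin (\<lambda>b. Ret (bit b)))"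
  unfolding small_def by (rule exI[of _ 1]) (auto simp: bit_def)

lemma ppt_ask: "ppt (\<lambda>x. Ask i x Ret)"
proof (rule pptI)
  fix x
  let ?s = "(\<lambda>_. Leaf)(0 := x)"
  show "exec (Query 0 i (Var 0)) ?s (Ask i x (\<lambda>a. Ret (?s(0 := a)))) (poly [:2, 1:] (size x))"
    using exec.Query[of "Var 0" ?s "2 + size x" 0 i] by simp
qed (simp add: comp_def)

text \<open>The continuation is a program on the pair of input and intermediate result. Building
  this pair costs its size, and the time of \<open>B\<close> is polynomial in that size;
  \<open>small A\<close> controls both.\<close>

lemma ppt_bind:
  assumes "ppt A" "small A" "ppt (\<lambda>z. B (left z) (right z))"
  shows "ppt (\<lambda>x. bind_itree (A x) (\<lambda>y. B x y))"
proof -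
  obtain p where p: "\<And>k y e. y < k \<Longrightarrow> \<exists>c. \<forall>s. (\<forall>z\<ge>k. s z = Leaf) \<longrightarrow>
    exec c s (map_itree (\<lambda>a. s(y := a)) (A (eval e s))) (cost e s + poly p (size (eval e s)))"
    using ppt_call[OF assms(1)] by blast
  obtain q where q: "\<And>k y e. y < k \<Longrightarrow> \<exists>c. \<forall>s. (\<forall>z\<ge>k. s z = Leaf) \<longrightarrow>
    exec c s (map_itree (\<lambda>a. s(y := a)) (B (left (eval e s)) (right (eval e s))))
      (cost e s + poly q (size (eval e s)))"
    using ppt_call[OF assms(3)] by blast
  obtain r where r: "\<And>x y. y \<in> set_itree (A x) \<Longrightarrow> size y \<le> poly r (size x)"
    using assms(2) unfolding small_def by blast
  obtain c where c: "\<And>s. (\<forall>z\<ge>2. s z = Leaf) \<Longrightarrow>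
    exec c s (map_itree (\<lambda>a. s(1 := a)) (A (s 0))) (1 + poly p (size (s 0)))"
    using p[of 1 2 "Var 0"] by auto
  obtain d where d: "\<And>s. (\<forall>z\<ge>2. s z = Leaf) \<Longrightarrow>
    exec d s (map_itree (\<lambda>a. s(0 := a)) (B (s 0) (s 1)))
      (3 + size (Node (s 0) (s 1)) + poly q (size (Node (s 0) (s 1))))"
    using q[of 0 2 "Mk (Var 0) (Var 1)"] by (auto simp: eval_nat_numeral)
  \<comment> \<open>Bounds the size of the pair \<open>Node x y\<close>.\<close>
  define u where "u = [:1, 1:] + r"
  show ?thesis
  proof (rule pptI)
    fix x
    let ?s = "(\<lambda>_. Leaf)(0 := x)"
    show "exec (Seq c d) ?s (bind_itree (map_itree (\<lambda>a. ?s(1 := a)) (A x))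
        (\<lambda>s. map_itree (\<lambda>a. s(0 := a)) (B x (s 1)))) (poly (4 + p + u + pcompose q u) (size x))"
    proof (rule exec_SeqI)
      show "exec c ?s (map_itree (\<lambda>a. ?s(1 := a)) (A x)) (1 + poly p (size x))"
        using c[of ?s] by simp
      fix s :: store assume "s \<in> set_itree (map_itree (\<lambda>a. ?s(1 := a)) (A x))"
      then obtain y where y: "y \<in> set_itree (A x)" "s = ?s(1 := y)"
        by (auto simp: itree.set_map)
      have "size (Node x y) \<le> poly u (size x)"
        using r[OF y(1)] by (simp add: u_def)
      then have "3 + size (Node x y) + poly q (size (Node x y)) \<le> poly (3 + u + pcompose q u) (size x)"
        using poly_mono_nat[of "size (Node x y)" "poly u (size x)" q] by (simp add: poly_pcompose)
      moreover have "exec d s (map_itree (\<lambda>a. s(0 := a)) (B x (s 1)))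
          (3 + size (Node x y) + poly q (size (Node x y)))"
        using d[of s] y by simp
      ultimately show "exec d s (map_itree (\<lambda>a. s(0 := a)) (B x (s 1)))
          (poly (3 + u + pcompose q u) (size x))"
        using exec_mono by blast
    qed (auto simp: algebra_simps)
    show "bind_itree (A x) (B x) = map_itree (\<lambda>s. s 0) (bind_itree (map_itree (\<lambda>a. ?s(1 := a)) (A x))
        (\<lambda>s. map_itree (\<lambda>a. s(0 := a)) (B x (s 1))))"
      by (simp add: map_itree_conv_bind bind_itree_assoc)
  qed
qed

lemma small_bind:
  assumes "small A" "small (\<lambda>z. B (left z) (right z))"
  shows "small (\<lambda>x. bind_itree (A x) (\<lambda>y. B x y))"
proof -
  obtain r where r: "\<And>x y. y \<in> set_itree (A x) \<Longrightarrow> size y \<le> poly r (size x)"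
    using assms(1) unfolding small_def by blast
  obtain q where q: "\<And>x y. y \<in> set_itree (B (left x) (right x)) \<Longrightarrow> size y \<le> poly q (size x)"
    using assms(2) unfolding small_def by blast
  define u where "u = [:1, 1:] + r"
  have "size z \<le> poly (pcompose q u) (size x)" if "y \<in> set_itree (A x)" "z \<in> set_itree (B x y)" for x y z
  proof -
    have "size (Node x y) \<le> poly u (size x)"
      using r[OF that(1)] by (simp add: u_def)
    then have "poly q (size (Node x y)) \<le> poly (pcompose q u) (size x)"
      using poly_mono_nat by (simp add: poly_pcompose)
    then show ?thesis using q[of z "Node x y"] that by simp
  qed
  then show ?thesis unfolding small_def
    by (intro exI[of _ "pcompose q u"]) (auto simp: set_bind_itree)
qed

text \<open>No bound on the result of \<open>A\<close> is needed here, as it is only tested.\<close>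

lemma ppt_branch:
  assumes "ppt A" "ppt B1" "ppt B0"
  shows "ppt (\<lambda>x. bind_itree (A x) (\<lambda>y. if to_bool y then B1 x else B0 x))"
proof -
  obtain c p where c: "\<And>s. (\<forall>z\<ge>2. s z = Leaf) \<Longrightarrow>
    exec c s (map_itree (\<lambda>a. s(1 := a)) (A (s 0))) (1 + poly p (size (s 0)))"
  proof -
    obtain p where p: "\<And>k y e. y < k \<Longrightarrow> \<exists>c. \<forall>s. (\<forall>z\<ge>k. s z = Leaf) \<longrightarrow>
      exec c s (map_itree (\<lambda>a. s(y := a)) (A (eval e s))) (cost e s + poly p (size (eval e s)))"
      using ppt_call[OF assms(1)] by blast
    show thesis using p[of 1 2 "Var 0"] that by auto
  qed
  have B: "\<exists>d q. \<forall>s. (\<forall>z\<ge>2. s z = Leaf) \<longrightarrow>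
    exec d s (map_itree (\<lambda>a. s(0 := a)) (B (s 0))) (1 + poly q (size (s 0)))" if ppt: "ppt B" for B
  proof -
    obtain p where p: "\<And>k y e. y < k \<Longrightarrow> \<exists>c. \<forall>s. (\<forall>z\<ge>k. s z = Leaf) \<longrightarrow>
      exec c s (map_itree (\<lambda>a. s(y := a)) (B (eval e s))) (cost e s + poly p (size (eval e s)))"
      using ppt_call[OF ppt] by blast
    show ?thesis using p[of 0 2 "Var 0"] by auto
  qed
  obtain d1 q1 where d1: "\<And>s. (\<forall>z\<ge>2. s z = Leaf) \<Longrightarrow>
    exec d1 s (map_itree (\<lambda>a. s(0 := a)) (B1 (s 0))) (1 + poly q1 (size (s 0)))"
    using B[OF assms(2)] by blast
  obtain d0 q0 where d0: "\<And>s. (\<forall>z\<ge>2. s z = Leaf) \<Longrightarrow>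
    exec d0 s (map_itree (\<lambda>a. s(0 := a)) (B0 (s 0))) (1 + poly q0 (size (s 0)))"
    using B[OF assms(3)] by blast
  let ?B = "\<lambda>x y. if to_bool y then B1 x else B0 x"
  show ?thesis
  proof (rule pptI)
    fix x
    let ?s = "(\<lambda>_. Leaf)(0 := x)"
    show "exec (Seq c (If (Var 1) d1 d0)) ?s (bind_itree (map_itree (\<lambda>a. ?s(1 := a)) (A x))
        (\<lambda>s. map_itree (\<lambda>a. s(0 := a)) (?B x (s 1)))) (poly (4 + p + q1 + q0) (size x))"
    proof (rule exec_SeqI)
      show "exec c ?s (map_itree (\<lambda>a. ?s(1 := a)) (A x)) (1 + poly p (size x))"
        using c[of ?s] by simp
      fix s :: store assume "s \<in> set_itree (map_itree (\<lambda>a. ?s(1 := a)) (A x))"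
      then obtain y where y: "s = ?s(1 := y)"
        by (auto simp: itree.set_map)
      show "exec (If (Var 1) d1 d0) s (map_itree (\<lambda>a. s(0 := a)) (?B x (s 1)))
          (3 + poly q1 (size x) + poly q0 (size x))"
      proof (cases "to_bool y")
        case True
        have "exec (If (Var 1) d1 d0) s (map_itree (\<lambda>a. s(0 := a)) (B1 x))
            (cost (Var 1) s + 1 + (1 + poly q1 (size x)))"
          by (rule exec.If_True) (use True y d1[of s] in auto)
        then show ?thesis using True y exec_mono by fastforce
      next
        case False
        have "exec (If (Var 1) d1 d0) s (map_itree (\<lambda>a. s(0 := a)) (B0 x))
            (cost (Var 1) s + 1 + (1 + poly q0 (size x)))"
          by (rule exec.If_False) (use False y d0[of s] in auto)
        then show ?thesis using False y exec_mono by fastforce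
      qed
    qed (auto simp: algebra_simps)
    show "bind_itree (A x) (?B x) = map_itree (\<lambda>s. s 0) (bind_itree (map_itree (\<lambda>a. ?s(1 := a)) (A x))
        (\<lambda>s. map_itree (\<lambda>a. s(0 := a)) (?B x (s 1))))"
      by (simp add: map_itree_conv_bind bind_itree_assoc)
  qed
qed

lemma small_branch:
  assumes "small B1" "small B0"
  shows "small (\<lambda>x. bind_itree (A x) (\<lambda>y. if to_bool y then B1 x else B0 x))"
proof -
  obtain p where p: "\<And>x y. y \<in> set_itree (B1 x) \<Longrightarrow> size y \<le> poly p (size x)"
    using assms(1) unfolding small_def by blast
  obtain q where q: "\<And>x y. y \<in> set_itree (B0 x) \<Longrightarrow> size y \<le> poly q (size x)"
    using assms(2) unfolding small_def by blast
  show ?thesis unfolding small_def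
    by (rule exI[of _ "p + q"])
      (auto simp: set_bind_itree split: if_splits dest!: p q intro: trans_le_add1 trans_le_add2)
qed

text \<open>The input \<open>x\<close> stays in variable 0, where the handlers find it, and the
  program of \<open>A\<close> works from variable 1 on. Its time bound holds for answers of any size
  and limits the size of its queries, hence the time of each handler call.\<close>

lemma ppt_subst:
  assumes "ppt A" "expr_fun f" "ppt (\<lambda>z. h0 (left z) (right z))" "ppt (\<lambda>z. h1 (left z) (right z))"
  shows "ppt (\<lambda>x. subst_itree (\<lambda>i q. if i = 0 then h0 x q else h1 x q) (A (f x)))"
proof -
  from assms(1) obtain c0 p0 where c0: "\<And>x. \<exists>t.
     exec c0 ((\<lambda>_. Leaf)(0 := x)) t (poly p0 (size x)) \<and> A x = map_itree (\<lambda>s. s 0) t"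
    unfolding ppt_def by metis
  from assms(2) obtain e K where
    e: "\<And>s. eval e s = f (s 0) \<and> cost e s \<le> K * Suc (size (s 0)) \<and> size (f (s 0)) \<le> K * Suc (size (s 0))"
    unfolding expr_fun_def by metis
  define N where "N = Suc (top_var c0)"
  \<comment> \<open>\<open>ppt_call\<close> gives one program for each target variable and argument
    expression; choosing them all at once yields the function that \<open>translate\<close> takes.
    Scratch space starts at \<open>Suc N\<close>, above the moved program.\<close>
  have h: "\<exists>H q. \<forall>y e s. y < Suc N \<longrightarrow> (\<forall>z\<ge>Suc N. s z = Leaf) \<longrightarrow>
      exec (H y e) s (map_itree (\<lambda>a. s(y := a)) (h (s 0) (eval e s)))
        (3 + cost e s + size (s 0) + size (eval e s) + poly q (size (s 0) + size (eval e s) + 1))"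
    if ppt: "ppt (\<lambda>z. h (left z) (right z))" for h
  proof -
    obtain q where q: "\<And>k y e. y < k \<Longrightarrow> \<exists>c. \<forall>s. (\<forall>z\<ge>k. s z = Leaf) \<longrightarrow>
      exec c s (map_itree (\<lambda>a. s(y := a)) (h (left (eval e s)) (right (eval e s))))
        (cost e s + poly q (size (eval e s)))"
      using ppt_call[OF ppt] by blast
    have "\<exists>c. y < Suc N \<longrightarrow> (\<forall>s. (\<forall>z\<ge>Suc N. s z = Leaf) \<longrightarrow>
      exec c s (map_itree (\<lambda>a. s(y := a)) (h (s 0) (eval e s)))
        (3 + cost e s + size (s 0) + size (eval e s) + poly q (size (s 0) + size (eval e s) + 1)))" for y e
      using q[of y "Suc N" "Mk (Var 0) e"] by (auto simp: algebra_simps eval_nat_numeral)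
    then show ?thesis by metis
  qed
  obtain H0 q0 where H0: "\<And>y e s. y < Suc N \<Longrightarrow> (\<forall>z\<ge>Suc N. s z = Leaf) \<Longrightarrow>
      exec (H0 y e) s (map_itree (\<lambda>a. s(y := a)) (h0 (s 0) (eval e s)))
        (3 + cost e s + size (s 0) + size (eval e s) + poly q0 (size (s 0) + size (eval e s) + 1))"
    using h[OF assms(3)] by blast
  obtain H1 q1 where H1: "\<And>y e s. y < Suc N \<Longrightarrow> (\<forall>z\<ge>Suc N. s z = Leaf) \<Longrightarrow>
      exec (H1 y e) s (map_itree (\<lambda>a. s(y := a)) (h1 (s 0) (eval e s)))
        (3 + cost e s + size (s 0) + size (eval e s) + poly q1 (size (s 0) + size (eval e s) + 1))"
    using h[OF assms(4)] by blast
  define H where "H = (\<lambda>i y e. if i = (0::nat) then H0 y e else H1 y e)"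
  obtain t where t: "\<And>x. exec c0 ((\<lambda>_. Leaf)(0 := x)) (t x) (poly p0 (size x))"
    and A: "\<And>x. A x = map_itree (\<lambda>s. s 0) (t x)"
    using c0 by metis
  \<comment> \<open>\<open>np\<close> bounds the time of \<open>A\<close> on \<open>f x\<close> and
    with it the size of its queries; \<open>wp\<close> bounds a handler call on the input paired
    with such a query.\<close>
  define np where "np = pcompose p0 [:K, K:]"
  define wp where "wp = 3 + [:0, 1:] + np + pcompose q0 ([:1, 1:] + np) + pcompose q1 ([:1, 1:] + np)"
  show ?thesis
  proof (rule pptI)
    fix x
    let ?s = "(\<lambda>_. Leaf)(0 := x)"
    let ?h = "\<lambda>i q. if i = 0 then h0 x q else h1 x q"
    define n where "n = poly np (size x)"
    define w where "w = poly wp (size x)"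
    have n: "poly p0 (size (f x)) \<le> n"
      using e[of ?s] poly_mono_nat[of "size (f x)" "K + size x * K" p0]
      by (simp add: n_def np_def poly_pcompose algebra_simps)
    have w: "3 + size x + size d + poly q0 (size x + size d + 1) \<le> w"
      "3 + size x + size d + poly q1 (size x + size d + 1) \<le> w" if "size d \<le> n" for d :: data
      using poly_mono_nat[of "size x + size d + 1" "size x + n + 1" q0] that
        poly_mono_nat[of "size x + size d + 1" "size x + n + 1" q1]
      by (simp_all add: w_def wp_def n_def poly_pcompose algebra_simps)
    have run: "exec (translate 1 H c0) (overlay 1 ?s ((\<lambda>_. Leaf)(0 := f x)))
        (map_itree (overlay 1 ?s) (subst_itree ?h (t (f x)))) (n * Suc w)"
    proof (rule exec_translate[where N = N and M = n])
      fix i y e' s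
      assume *: "y < N" "\<forall>v\<ge>N. s v = Leaf" "size (eval e' s) \<le> n"
      let ?u = "overlay 1 ?s s"
      have u: "\<forall>z\<ge>Suc N. ?u z = Leaf" "?u 0 = x"
        using *(2) by (auto simp: overlay_def)
      have y: "1 + y < Suc N" using *(1) by simp
      have upd: "fun_upd ?u (1 + y) = (\<lambda>a. overlay 1 ?s (s(y := a)))"
        by (rule ext, rule overlay_upd)
      show "exec (H i (1 + y) (shift_expr 1 e')) ?u
        (map_itree (\<lambda>a. overlay 1 ?s (s(y := a))) (?h i (eval e' s))) (cost e' s + w)"
        unfolding upd[symmetric]
      proof (cases "i = 0")
        case True
        have "exec (H0 (1 + y) (shift_expr 1 e')) ?u (map_itree (fun_upd ?u (1 + y)) (h0 x (eval e' s)))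
          (cost e' s + w)"
          by (rule exec_mono[OF H0[OF y u(1), of "shift_expr 1 e'", unfolded u(2) eval_shift cost_shift]])
            (use w(1)[OF *(3)] in linarith)
        then show "exec (H i (1 + y) (shift_expr 1 e')) ?u (map_itree (fun_upd ?u (1 + y)) (?h i (eval e' s)))
          (cost e' s + w)"
          using True by (simp add: H_def)
      next
        case False
        have "exec (H1 (1 + y) (shift_expr 1 e')) ?u (map_itree (fun_upd ?u (1 + y)) (h1 x (eval e' s)))
          (cost e' s + w)"
          by (rule exec_mono[OF H1[OF y u(1), of "shift_expr 1 e'", unfolded u(2) eval_shift cost_shift]])
            (use w(2)[OF *(3)] in linarith)
        then show "exec (H i (1 + y) (shift_expr 1 e')) ?u (map_itree (fun_upd ?u (1 + y)) (?h i (eval e' s)))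
          (cost e' s + w)"
          using False by (simp add: H_def)
      qed
    qed (use exec_mono[OF t n] in \<open>auto simp: N_def\<close>)
    show "exec (Seq (Assign 1 e) (Seq (translate 1 H c0) (Assign 0 (Var 1)))) ?s
        (bind_itree (subst_itree ?h (t (f x))) (\<lambda>r. Ret ((overlay 1 ?s r)(0 := r 0))))
        (poly ([:K + 1, K:] + np * (wp + 1) + 2) (size x))"
    proof (rule exec_SeqI)
      show "exec (Assign 1 e) ?s (Ret (?s(1 := f x))) (K * Suc (size x) + 1)"
        using exec.Assign[of e ?s "K * Suc (size x) + 1" 1] e[of ?s] by simp
      fix s' :: store assume "s' \<in> set_itree (Ret (?s(1 := f x)))"
      then have s': "s' = overlay 1 ?s ((\<lambda>_. Leaf)(0 := f x))" by (auto simp: overlay_def)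
      show "exec (Seq (translate 1 H c0) (Assign 0 (Var 1))) s'
        (bind_itree (subst_itree ?h (t (f x))) (\<lambda>r. Ret ((overlay 1 ?s r)(0 := r 0)))) (n * Suc w + 2)"
        unfolding s'
      proof (rule exec_SeqI[OF run])
        fix u
        show "exec (Assign 0 (Var 1)) u (Ret (u(0 := u 1))) 2"
          using exec.Assign[of "Var 1" u 2 0] by simp
      qed (auto simp: bind_map_itree overlay_def)
    qed (auto simp: n_def w_def algebra_simps)
    show "subst_itree ?h (A (f x)) = map_itree (\<lambda>s. s 0)
        (bind_itree (subst_itree ?h (t (f x))) (\<lambda>r. Ret ((overlay 1 ?s r)(0 := r 0))))"
      by (simp add: A map_itree_conv_bind subst_bind_itree bind_itree_assoc)
  qed
qed

lemma ppt_comp: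
  assumes "ppt A" "expr_fun f"
  shows "ppt (\<lambda>x. A (f x))"
proof -
  from assms(2) obtain e K where
    e: "\<And>s. eval e s = f (s 0) \<and> cost e s \<le> K * Suc (size (s 0)) \<and> size (f (s 0)) \<le> K * Suc (size (s 0))"
    unfolding expr_fun_def by metis
  obtain p where p: "\<And>k y e. y < k \<Longrightarrow> \<exists>c. \<forall>s. (\<forall>z\<ge>k. s z = Leaf) \<longrightarrow>
    exec c s (map_itree (\<lambda>a. s(y := a)) (A (eval e s))) (cost e s + poly p (size (eval e s)))"
    using ppt_call[OF assms(1)] by blast
  obtain c where c: "\<And>s. (\<forall>z\<ge>1. s z = Leaf) \<Longrightarrow>
    exec c s (map_itree (\<lambda>a. s(0 := a)) (A (f (s 0)))) (cost e s + poly p (size (f (s 0))))"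
    using p[of 0 1 e] e by auto
  show ?thesis
  proof (rule pptI)
    fix x
    let ?s = "(\<lambda>_. Leaf)(0 := x)"
    have "cost e ?s + poly p (size (f x)) \<le> poly ([:K, K:] + pcompose p [:K, K:]) (size x)"
      using e[of ?s] poly_mono_nat[of "size (f x)" "K + size x * K" p]
      by (simp add: poly_pcompose algebra_simps)
    then show "exec c ?s (map_itree (\<lambda>a. ?s(0 := a)) (A (f x))) (poly ([:K, K:] + pcompose p [:K, K:]) (size x))"
      using c[of ?s] exec_mono by fastforce
    show "A (f x) = map_itree (\<lambda>s. s 0) (map_itree (\<lambda>a. ?s(0 := a)) (A (f x)))"
      by (simp add: map_itree_conv_bind bind_itree_assoc)
  qed
qed

lemma small_comp:
  assumes "small A" "expr_fun f"
  shows "small (\<lambda>x. A (f x))"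
proof -
  obtain p where p: "\<And>x y. y \<in> set_itree (A x) \<Longrightarrow> size y \<le> poly p (size x)"
    using assms(1) unfolding small_def by blast
  from assms(2) obtain K where K: "\<And>s::store. size (f (s 0)) \<le> K * Suc (size (s 0))"
    unfolding expr_fun_def by metis
  have "size y \<le> poly (pcompose p [:K, K:]) (size x)" if "y \<in> set_itree (A (f x))" for x y
    using p[OF that] poly_mono_nat[of "size (f x)" "K + size x * K" p] K[of "\<lambda>_. x"]
    by (simp add: poly_pcompose algebra_simps)
  then show ?thesis unfolding small_def by blast
qed

lemma ppt_silence: "ppt A \<Longrightarrow> expr_fun f \<Longrightarrow> ppt (\<lambda>x. silence (A (f x)))"
  using ppt_subst[of A f "\<lambda>_ _. Ret Leaf" "\<lambda>_ _. Ret Leaf"] by (simp add: ppt_Ret expr_fun_const)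

lemma small_silence_comp: "ppt A \<Longrightarrow> expr_fun f \<Longrightarrow> small (\<lambda>x. silence (A (f x)))"
  using small_comp[OF small_silence] by simp

lemma ppt_if:
  assumes "expr_fun f" "ppt A" "ppt B" shows "ppt (\<lambda>x. if to_bool (f x) then A x else B x)"
  using ppt_branch[OF ppt_Ret[OF assms(1)] assms(2,3)] by simp

lemma small_if:
  assumes "small A" "small B" shows "small (\<lambda>x. if to_bool (f x) then A x else B x)"
  using small_branch[OF assms, of "\<lambda>x. Ret (f x)"] by simp

lemma ppt_then:
  assumes "ppt A" "ppt B" shows "ppt (\<lambda>x. bind_itree (A x) (\<lambda>_. B x))"
  using ppt_branch[OF assms assms(2)] by simp

lemma ppt_Ask: "expr_fun f \<Longrightarrow> ppt (\<lambda>x. Ask i (f x) Ret)"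
  by (rule ppt_comp[OF ppt_ask])

lemma to_bool_bit [simp]: "to_bool (bit b) = b"
  by (simp add: bit_def to_bool_def)

lemma item_simps [simp]:
  "item 0 d = left d" "item (Suc i) d = item i (right d)" "item (numeral k) d = item (pred_numeral k) (right d)"
  by (simp_all add: item_def numeral_eq_Suc funpow_swap1)

section \<open>The adversaries of the reductions\<close>

text \<open>The number \<open>m\<close> of issuers is a constant of the setting, so the search is unrolled into
  conditionals.\<close>

primrec lookup :: "nat \<Rightarrow> data \<Rightarrow> data \<Rightarrow> data" where
  "lookup 0 J i = Leaf"
| "lookup (Suc m) J i = (if item 0 (left J) = i then item 1 (left J) else lookup m (right J) i)"

lemma lookup_jwks:
  "lookup (length ops) (jwks ops) i = (case map_of ops i of None \<Rightarrow> Leaf | Some (sk, pk) \<Rightarrow> pk)"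
  by (induction ops) (auto simp: jwks_def split: option.splits)

lemma Ret_lookup_Suc:
  "Ret (lookup (Suc m) J i) = (if to_bool (bit (item 0 (left J) = i)) then Ret (item 1 (left J))
     else Ret (lookup m (right J) i))"
  by simp

lemma ppt_lookup: "expr_fun f \<Longrightarrow> expr_fun g \<Longrightarrow> ppt (\<lambda>x. Ret (lookup m (f x) (g x)))"
proof (induction m arbitrary: f)
  case (Suc m)
  show ?case unfolding Ret_lookup_Suc
    by (intro ppt_if ppt_Ret Suc.IH expr_fun_intros Suc.prems)
qed (simp add: ppt_Ret expr_fun_const)

lemma small_lookup: "expr_fun f \<Longrightarrow> expr_fun g \<Longrightarrow> small (\<lambda>x. Ret (lookup m (f x) (g x)))"
proof (induction m arbitrary: f)
  case (Suc m)
  show ?case unfolding Ret_lookup_Suc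
    by (intro small_if small_Ret Suc.IH expr_fun_intros Suc.prems)
qed (simp add: small_Ret expr_fun_const)

text \<open>The query lists address, issuer, message and expiry; the tag wants key, issuer, address
  and expiry. The bind after \<open>Ret\<close> makes the lookup a program of its own, in the shape
  composed by \<open>ppt_bind\<close>.\<close>

definition forward :: "nat \<Rightarrow> data \<Rightarrow> data \<Rightarrow> data itree" where
  "forward m J q = bind_itree (Ret (lookup m J (item 1 q)))
     (\<lambda>pk. Ask 0 (tup [tup [pk, item 1 q, item 0 q, item 3 q], item 2 q]) Ret)"

text \<open>\<open>G\<close> and \<open>H\<close> compute salts and hashes, and \<open>x\<close>
  holds security parameter, public key and published keys. Registration precedes \<open>A2\<close>,
  so that the honest user owns the challenge address first. The last test outputs whether
  \<open>A2\<close> guessed \<open>b\<close>; for distinct issuers \<open>b\<close> itself is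
  returned, as in the game.\<close>

definition wh_adversary where
  "wh_adversary m G H A1 A2 x =
     bind_itree (Coin (\<lambda>b. Ret (bit b))) (\<lambda>b.
     bind_itree (silence (A1 x)) (\<lambda>out.
     if to_bool (bit (item 2 (item 0 out) = item 2 (item 1 out))) then
       bind_itree (if to_bool b then Ret (item 1 out) else Ret (item 0 out)) (\<lambda>C.
       bind_itree (silence (G (item 0 x))) (\<lambda>salt.
       bind_itree (silence (H (tup [item 0 C, item 1 C, item 2 C, salt]))) (\<lambda>zkaddr.
       bind_itree (Ask 1 (tup [C, salt]) Ret) (\<lambda>_.
       bind_itree
         (subst_itree (\<lambda>i q. if i = 0 then forward m (item 2 x) q else Ask 1 q Ret)
           (A2 (tup [item 0 x, item 2 out, zkaddr])))
         (\<lambda>b'. if to_bool b' then Ret b else Ret (bit (b = Leaf)))))))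
     else Ret b))"

lemma ppt_wh_adversary:
  assumes "ppt G" "ppt H" "ppt A1" "ppt A2"
  shows "ppt (wh_adversary m G H A1 A2)"
  unfolding wh_adversary_def[abs_def] forward_def tup_simps
  apply (rule ppt_bind[OF ppt_coin small_coin])
  apply (rule ppt_bind)
    apply (rule ppt_silence[OF assms(3)], intro expr_fun_intros)
   apply (rule small_silence_comp[OF assms(3)], intro expr_fun_intros)
  apply (rule ppt_if)
    apply (intro expr_fun_intros)
   apply (rule ppt_bind)
     apply (intro ppt_if ppt_Ret expr_fun_intros)
    apply (intro small_if small_Ret expr_fun_intros)
   apply (rule ppt_bind)
     apply (rule ppt_silence[OF assms(1)], intro expr_fun_intros)
    apply (rule small_silence_comp[OF assms(1)], intro expr_fun_intros)
   apply (rule ppt_bind)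
     apply (rule ppt_silence[OF assms(2)], intro expr_fun_intros)
    apply (rule small_silence_comp[OF assms(2)], intro expr_fun_intros)
   apply (rule ppt_then)
    apply (rule ppt_Ask, intro expr_fun_intros)
   apply (rule ppt_branch)
     apply (rule ppt_subst[OF assms(4)])
       apply (intro expr_fun_intros)
      apply (rule ppt_bind)
        apply (rule ppt_lookup; intro expr_fun_intros)
       apply (rule small_lookup; intro expr_fun_intros)
      apply (rule ppt_Ask, intro expr_fun_intros)
     apply (rule ppt_Ask, intro expr_fun_intros)
    apply (rule ppt_Ret, intro expr_fun_intros)
   apply (rule ppt_Ret, intro expr_fun_intros)
  apply (rule ppt_Ret, intro expr_fun_intros)
  done

text \<open>Only public keys are kept: simulated signing never calls on a provider to issue a
  token.\<close>

primrec sample_jwks :: "(data \<Rightarrow> data itree) \<Rightarrow> data list \<Rightarrow> data \<Rightarrow> data itree" where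
  "sample_jwks K [] u = Ret Leaf"
| "sample_jwks K (i # is) u =
     bind_itree (silence (K u)) (\<lambda>k.
     bind_itree (sample_jwks K is u) (\<lambda>J. Ret (Node (tup [i, item 1 k]) J)))"

lemma sample_jwks_ppt_small:
  assumes "ppt K" shows "ppt (sample_jwks K is) \<and> small (sample_jwks K is)"
proof (induction "is")
  case Nil
  then show ?case by (simp add: ppt_Ret small_Ret expr_fun_const)
next
  case (Cons i "is")
  have "ppt (\<lambda>u. sample_jwks K (i # is) u)" unfolding sample_jwks.simps tup_simps
    apply (rule ppt_bind)
      apply (rule ppt_silence[OF assms], rule expr_fun_id)
     apply (rule small_silence[OF assms])
    apply (rule ppt_bind)
      apply (rule ppt_comp[OF conjunct1[OF Cons]], intro expr_fun_intros)
     apply (rule small_comp[OF conjunct2[OF Cons]], intro expr_fun_intros)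
    apply (rule ppt_Ret, intro expr_fun_intros)
    done
  moreover have "small (\<lambda>u. sample_jwks K (i # is) u)" unfolding sample_jwks.simps tup_simps
    apply (rule small_bind)
     apply (rule small_silence[OF assms])
    apply (rule small_bind)
     apply (rule small_comp[OF conjunct2[OF Cons]], intro expr_fun_intros)
    apply (rule small_Ret, intro expr_fun_intros)
    done
  ultimately show ?case by simp
qed

text \<open>The state passed to the guesser has the state of \<open>A1\<close>, the simulated key with its trapdoor, the
  published keys, and whether the issuers agree.\<close>

definition hiding_chooser where
  "hiding_chooser is K S A1 x =
     bind_itree (sample_jwks K is (item 0 x)) (\<lambda>J.
     bind_itree (silence (S (item 0 x))) (\<lambda>g.
     bind_itree (silence (A1 (tup [item 0 x, item 0 g, J]))) (\<lambda>out.
     Ret (tup [item 0 out, item 1 out,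
       tup [item 2 out, g, J, bit (item 2 (item 0 out) = item 2 (item 1 out))]]))))"

definition simulate :: "nat \<Rightarrow> (data \<Rightarrow> data itree) \<Rightarrow> data \<Rightarrow> data \<Rightarrow> data \<Rightarrow> data itree" where
  "simulate m S J g q = bind_itree (Ret (lookup m J (item 1 q)))
     (\<lambda>pk. silence (S (tup [tup [pk, item 1 q, item 0 q, item 3 q], item 0 g, item 1 g, item 2 q])))"

text \<open>Registrations get the empty answer and leave no trace, since simulated signatures do not
  depend on the accounts.\<close>

definition hiding_guesser where
  "hiding_guesser m S A2 x =
     (if to_bool (item 3 (item 1 x)) then
        subst_itree (\<lambda>i q. if i = 0 then simulate m S (item 2 (item 1 x)) (item 1 (item 1 x)) q else Ret Leaf)
          (A2 (tup [item 0 x, item 0 (item 1 x), item 2 x]))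
      else Ret Leaf)"

lemma ppt_hiding_chooser:
  assumes "ppt K" "ppt S" "ppt A1"
  shows "ppt (hiding_chooser is K S A1)"
  unfolding hiding_chooser_def[abs_def] tup_simps
  apply (rule ppt_bind)
    apply (rule ppt_comp[OF conjunct1[OF sample_jwks_ppt_small[OF assms(1)]]], intro expr_fun_intros)
   apply (rule small_comp[OF conjunct2[OF sample_jwks_ppt_small[OF assms(1)]]], intro expr_fun_intros)
  apply (rule ppt_bind)
    apply (rule ppt_silence[OF assms(2)], intro expr_fun_intros)
   apply (rule small_silence_comp[OF assms(2)], intro expr_fun_intros)
  apply (rule ppt_bind)
    apply (rule ppt_silence[OF assms(3)], intro expr_fun_intros)
   apply (rule small_silence_comp[OF assms(3)], intro expr_fun_intros)
  apply (rule ppt_Ret, intro expr_fun_intros)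
  done

lemma ppt_hiding_guesser:
  assumes "ppt S" "ppt A2"
  shows "ppt (hiding_guesser m S A2)"
  unfolding hiding_guesser_def[abs_def] simulate_def tup_simps
  apply (rule ppt_if)
    apply (intro expr_fun_intros)
   apply (rule ppt_subst[OF assms(2)])
     apply (intro expr_fun_intros)
    apply (rule ppt_bind)
      apply (rule ppt_lookup; intro expr_fun_intros)
     apply (rule small_lookup; intro expr_fun_intros)
    apply (rule ppt_silence[OF assms(1)], intro expr_fun_intros)
   apply (intro ppt_Ret expr_fun_intros)+
  done

section \<open>Executions of the adversaries\<close>

lemma run_bind:
  "run orc (bind_itree t f) s = bind_pmf (run orc t s) (\<lambda>(a, s'). run orc (f a) s')"
  by (induction t arbitrary: s)
    (auto simp: bind_return_pmf bind_assoc_pmf split_beta intro!: bind_pmf_cong)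

lemma sample_simps [simp]:
  "sample (Ret a) = return_pmf a"
  "sample (Coin k) = bind_pmf coin (\<lambda>b. sample (k b))"
  "sample (Ask i q f) = sample (f Leaf)"
  by (simp_all add: sample_def map_bind_pmf bind_return_pmf)

lemma sample_bind: "sample (bind_itree t f) = bind_pmf (sample t) (\<lambda>a. sample (f a))"
  by (induction t) (simp_all add: bind_return_pmf bind_assoc_pmf)

lemma sample_silence [simp]: "sample (silence t) = sample t"
  by (induction t) (simp_all add: sample_bind bind_return_pmf)

lemma run_silence: "run orc (silence t) s = map_pmf (\<lambda>a. (a, s)) (sample t)"
  by (induction t) (simp_all add: map_bind_pmf)

lemma rel_pmf_bind_reflI:
  assumes "\<And>x. x \<in> set_pmf p \<Longrightarrow> rel_pmf R (f x) (g x)"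
  shows "rel_pmf R (bind_pmf p f) (bind_pmf p g)"
  by (rule rel_pmf_bindI[where R = "\<lambda>x y. x = y \<and> x \<in> set_pmf p"])
    (auto intro: pmf.rel_refl_strong assms)

text \<open>A bisimulation between oracle states: equal answers lead the caller into the same
  continuation, so the relation survives the run.\<close>

lemma rel_run_subst:
  assumes step: "\<And>i q s1 s2. R s1 s2 \<Longrightarrow>
    rel_pmf (rel_prod (=) R) (run o1 (h1 i q) s1) (run o2 (h2 i q) s2)"
  shows "R s1 s2 \<Longrightarrow>
    rel_pmf (rel_prod (=) R) (run o1 (subst_itree h1 t) s1) (run o2 (subst_itree h2 t) s2)"
proof (induction t arbitrary: s1 s2)
  case (Coin k)
  then show ?case by (auto intro!: rel_pmf_bind_reflI)
next
  case (Ask i q k)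
  then show ?case
    by (auto simp: run_bind intro!: rel_pmf_bindI[OF step])
qed simp

lemma sample_subst_conv_run:
  assumes "\<And>i q. run orc (h1 i q) () = map_pmf (\<lambda>a. (a, ())) (sample (h2 i q))"
  shows "run orc (subst_itree h1 t) () = map_pmf (\<lambda>a. (a, ())) (sample (subst_itree h2 t))"
  by (induction t) (simp_all add: run_bind sample_bind assms map_bind_pmf bind_map_pmf)

section \<open>The real experiment and the unlinkability game\<close>

lemma length_sample_providers: "ops \<in> set_pmf (sample_providers Z n is) \<Longrightarrow> length ops = length is"
  by (induction "is" arbitrary: ops) (auto simp: split_beta)

lemma sample_providers_keys:
  "ops \<in> set_pmf (sample_providers Z n is) \<Longrightarrow> map_of ops i = Some (sk, pk) \<Longrightarrow>
    (sk, pk) \<in> set_pmf (jwt_gen (jwt Z) n)"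
  by (induction "is" arbitrary: ops) (auto simp: split_beta split: if_splits)

lemma sample_sample_jwks:
  assumes "sample (K u) = map_pmf (\<lambda>(sk, pk). tup [sk, pk]) (jwt_gen (jwt Z) n)"
  shows "sample (sample_jwks K is u) = map_pmf jwks (sample_providers Z n is)"
  by (induction "is")
    (auto simp: jwks_def sample_bind assms map_bind_pmf bind_map_pmf bind_return_pmf split_beta
      map_pmf_def[symmetric] pmf.map_comp comp_def intro!: bind_pmf_cong)

text \<open>The invariant behind the address clause of \<open>P_zkLogin\<close>; it covers users
  registered by the adversary, too.\<close>

definition consistent_accounts :: "setting \<Rightarrow> accounts \<Rightarrow> bool" where
  "consistent_accounts Z acc \<longleftrightarrow>
     (\<forall>i a st au sa. acc (i, a) = Some (st, au, sa) \<longrightarrow> a = hash Z (tup [st, au, i, sa]))"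

lemma consistent_accounts_register:
  "consistent_accounts Z acc \<Longrightarrow> consistent_accounts Z (register Z C salt acc)"
  by (auto simp: consistent_accounts_def register_def address_def Let_def simp del: tup_simps)

lemma consistent_accounts_empty: "consistent_accounts Z Map.empty"
  by (simp add: consistent_accounts_def)

text \<open>The real oracle tests the predicate before signing and the game does not. The test
  always succeeds: the token clauses hold by JWT correctness, the address clause by consistency, and
  the key pair is freshly generated.\<close>

lemma GetWitness_valid:
  assumes "jwt_correct (jwt Z)" "(sk, pk) \<in> set_pmf (jwt_gen (jwt Z) n)" "map_of ops i = Some (sk, pk)"
    and "consistent_accounts Z acc" "GetWitness Z n ops acc i a T = Some W" "(w, pk') \<in> set_pmf W"
  shows "pk' = pk \<and> P_zkLogin Z (tup [pk, i, a, T]) w"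
  using assms unfolding GetWitness_def consistent_accounts_def jwt_correct_def
  by (fastforce simp: P_zkLogin_def split_beta Let_def split: option.splits)

text \<open>For an unknown issuer the tag carries the key \<open>Leaf\<close>, and both oracles raise the flag.\<close>

lemma real_oracle_forward:
  assumes "jwt_correct (jwt Z)" "ops \<in> set_pmf (sample_providers Z n (issuers Z))"
    and "consistent_accounts Z acc"
  shows "run (real_oracle (P_zkLogin Z) (zkLogin_env Z) (Sigma_zkLogin Z) n pk)
      (forward (length (issuers Z)) (jwks ops) q) ((ops, acc), bad) =
    (case zkLoginSign Z n ops acc pk (item 0 q) (item 1 q) (item 2 q) (item 3 q) of
       None \<Rightarrow> return_pmf (Leaf, ((ops, acc), True))
     | Some S \<Rightarrow> map_pmf (\<lambda>\<sigma>. (\<sigma>, ((ops, acc), bad))) S)"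
proof (cases "GetWitness Z n ops acc (item 1 q) (item 0 q) (item 3 q)")
  case None
  then show ?thesis
    by (simp add: forward_def real_oracle_def zkLogin_env_def zkLoginSign_def Let_def bind_return_pmf)
next
  case (Some W)
  then obtain sk pk' where op: "map_of ops (item 1 q) = Some (sk, pk')"
    by (auto simp: GetWitness_def split: option.splits)
  have key: "(sk, pk') \<in> set_pmf (jwt_gen (jwt Z) n)"
    using sample_providers_keys[OF assms(2) op] .
  have lookup: "lookup (length (issuers Z)) (jwks ops) (item 1 q) = pk'"
    using lookup_jwks[of ops] length_sample_providers[OF assms(2)] op by simp
  have valid: "p' = pk' \<and> P_zkLogin Z (tup [pk', item 1 q, item 0 q, item 3 q]) w"
    if "(w, p') \<in> set_pmf W" for w p'
    using GetWitness_valid[OF assms(1) key op assms(3) Some that] .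
  show ?thesis
    using Some op lookup
    by (auto simp: forward_def real_oracle_def zkLogin_env_def zkLoginSign_def Let_def bind_return_pmf
        bind_map_pmf map_bind_pmf bind_assoc_pmf map_pmf_def[symmetric]
        dest: valid[simplified] intro!: bind_pmf_cong)
qed

lemma decode_claims_simps [simp]:
  "stid (decode_claims d) = item 0 d" "aud (decode_claims d) = item 1 d"
  "iss (decode_claims d) = item 2 d"
  by (simp_all add: decode_claims_def)

lemma bit_eq_Leaf [simp]: "bit b = Leaf \<longleftrightarrow> \<not> b"
  by (simp add: bit_def)

text \<open>The oracle is left arbitrary because both the real and the simulated experiment are
  unfolded through this form.\<close>

lemma run_wh_adversary:
  "run orc (wh_adversary m G H A1 A2 x) s = do {
     b \<leftarrow> coin;
     out \<leftarrow> sample (A1 x);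
     if item 2 (item 0 out) = item 2 (item 1 out) then do {
       let C = (if b then item 1 out else item 0 out);
       salt \<leftarrow> sample (G (item 0 x));
       zkaddr \<leftarrow> sample (H (tup [item 0 C, item 1 C, item 2 C, salt]));
       (_, s1) \<leftarrow> orc s 1 (tup [C, salt]);
       (b', s2) \<leftarrow> run orc
         (subst_itree (\<lambda>i q. if i = 0 then forward m (item 2 x) q else Ask 1 q Ret)
           (A2 (tup [item 0 x, item 2 out, zkaddr]))) s1;
       return_pmf (bit (to_bool b' = b), s2)
     } else return_pmf (bit b, s)
   }"
proof -
  have [simp]: "run orc (if to_bool b' then Ret (bit b) else Ret (bit (bit b = Leaf))) s2 =
    return_pmf (bit (to_bool b' = b), s2)" for b' b s2
    by (auto simp: bit_def)
  show ?thesis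
    unfolding wh_adversary_def
    by (auto simp: run_bind run_silence bind_map_pmf bind_assoc_pmf bind_return_pmf Let_def split_beta
        if_distrib[of "\<lambda>t. run orc t s" for s]
        intro!: bind_pmf_cong)
qed

lemma real_coupled_with_game:
  assumes "jwt_correct (jwt Z)" "\<And>x. sample (H x) = return_pmf (hash Z x)"
    and "\<And>n. sample (G (unary n)) = salt_gen Z n"
  shows "rel_pmf (\<lambda>(out, bad) (out', bad'). out = out' \<and> (bad \<longrightarrow> bad'))
    (expt_real (P_zkLogin Z) (zkLogin_env Z) (Sigma_zkLogin Z)
      (wh_adversary (length (issuers Z)) G H A1 A2) n)
    (UL_game Z A1 A2 n)"
proof -
  define Q where "Q = (\<lambda>(out :: bool, bad) (out', bad'). out = out' \<and> (bad \<longrightarrow> bad'))"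
  let ?orc = "real_oracle (P_zkLogin Z) (zkLogin_env Z) (Sigma_zkLogin Z) n"
  let ?h = "\<lambda>J i q. if i = (0 :: nat) then forward (length (issuers Z)) J q else Ask 1 q Ret"
  have oracles: "rel_pmf (rel_prod (=) R) (run (?orc pk) (subst_itree (?h (jwks ops)) t) ((ops, acc), False))
      (run (UL_oracle Z n ops pk C0 C1) t (acc, False))"
    if ops: "ops \<in> set_pmf (sample_providers Z n (issuers Z))" and acc: "consistent_accounts Z acc"
      and R: "R = (\<lambda>((ops', acc'), bad) (acc'', bad').
        ops' = ops \<and> acc'' = acc' \<and> consistent_accounts Z acc' \<and> (bad \<longrightarrow> bad'))"
    for ops pk acc C0 C1 t R
  proof -
    \<comment> \<open>The run in the game is written as a trivial substitution, so that one query of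
      \<open>A2\<close> is compared with one call of its handler.\<close>
    have "rel_pmf (rel_prod (=) R) (run (?orc pk) (subst_itree (?h (jwks ops)) t) ((ops, acc), False))
      (run (UL_oracle Z n ops pk C0 C1) (subst_itree (\<lambda>i q. Ask i q Ret) t) (acc, False))"
    proof (rule rel_run_subst)
      fix i q s1 s2
      assume "R s1 s2"
      then obtain acc' bad bad' where s: "s1 = ((ops, acc'), bad)" "s2 = (acc', bad')" "bad \<longrightarrow> bad'"
        "consistent_accounts Z acc'"
        by (auto simp: R split: prod.splits)
      show "rel_pmf (rel_prod (=) R) (run (?orc pk) (?h (jwks ops) i q) s1)
        (run (UL_oracle Z n ops pk C0 C1) (Ask i q Ret) s2)"
      proof (cases "i = 0")
        case True
        show ?thesis
        proof (cases "zkLoginSign Z n ops acc' pk (item 0 q) (item 1 q) (item 2 q) (item 3 q)")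
          case None
          then show ?thesis
            using True s unfolding s
            by (simp add: real_oracle_forward[OF assms(1) ops s(4)] del: item_simps)
               (simp add: UL_oracle_def R bind_return_pmf)
        next
          case (Some S)
          have "run (UL_oracle Z n ops pk C0 C1) (Ask i q Ret) s2 = map_pmf (\<lambda>\<sigma>. (\<sigma>, (acc', bad'))) S"
            using True Some by (simp add: UL_oracle_def s map_pmf_def bind_return_pmf bind_assoc_pmf)
          moreover have "run (?orc pk) (?h (jwks ops) i q) s1 = map_pmf (\<lambda>\<sigma>. (\<sigma>, ((ops, acc'), bad))) S"
            using True Some by (simp add: real_oracle_forward[OF assms(1) ops s(4)] s(1) del: item_simps)
          ultimately show ?thesis
            using s by (auto simp: pmf.rel_map R intro!: pmf.rel_refl)
        qed
      next
        case False
        then show ?thesis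
          using s consistent_accounts_register[OF s(4)]
          by (auto simp: real_oracle_def zkLogin_env_def UL_oracle_def R bind_return_pmf register_request_def)
      qed
    qed (use acc in \<open>simp add: R\<close>)
    then show ?thesis by simp
  qed
  have "rel_pmf Q (expt_real (P_zkLogin Z) (zkLogin_env Z) (Sigma_zkLogin Z)
      (wh_adversary (length (issuers Z)) G H A1 A2) n) (UL_game Z A1 A2 n)"
  proof -
    have env: "env_init (zkLogin_env Z) n =
        map_pmf (\<lambda>ops. ((ops, Map.empty), jwks ops)) (sample_providers Z n (issuers Z))"
      by (simp add: zkLogin_env_def map_pmf_def)
    \<comment> \<open>The reduction's own registration of the challenge user. It produces the
      accounts with which the game starts.\<close>
    have reg: "?orc pk ((ops, acc), bad) (Suc 0) q = return_pmf (Leaf, ((ops, register_request Z acc q), bad))"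
      for pk ops acc bad q
      by (simp add: real_oracle_def zkLogin_env_def)
    show ?thesis
      unfolding expt_real_def UL_game_def env zkLoginGen_def bind_map_pmf run_wh_adversary
      apply (simp add: bind_assoc_pmf bind_return_pmf reg Let_def split_beta register_request_def
          address_def assms(2,3) if_distrib[of "\<lambda>p. bind_pmf p f" for f] cong: if_cong)
      apply (rule rel_pmf_bind_reflI, rule rel_pmf_bind_reflI, rule rel_pmf_bind_reflI)
      subgoal for ops pk b
        by (cases b; auto simp: Q_def intro!: rel_pmf_bind_reflI
          rel_pmf_bindI[OF oracles[OF _ _ refl, unfolded One_nat_def]]
          consistent_accounts_register consistent_accounts_empty)
      done
  qed
  then show ?thesis by (simp add: Q_def)
qed

section \<open>The simulated experiment and the hiding game\<close>

lemma map_Not_coin: "map_pmf Not coin = coin"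
  by (rule pmf_eqI) (use pmf_map_inj'[of Not coin "\<not> i" for i] in \<open>auto simp: coin_def inj_def\<close>)

text \<open>The equality is exact: up to the order of independent samplings, the sides differ only
  for distinct issuers, where both are fair coins.\<close>

lemma sim_eq_hiding_game:
  assumes H: "\<And>x. sample (H x) = return_pmf (hash Z x)"
    and G: "\<And>n. sample (G (unary n)) = salt_gen Z n"
    and K: "\<And>n. sample (K (unary n)) = map_pmf (\<lambda>(sk, pk). tup [sk, pk]) (jwt_gen (jwt Z) n)"
    and SG: "\<And>n. sample (SG (unary n)) = map_pmf (\<lambda>(pk, trap). tup [pk, trap]) (SimGen n)"
    and SS: "\<And>t pk trap m. sample (SS (tup [t, pk, trap, m])) = SimSign t pk trap m"
  shows "expt_sim (zkLogin_env Z) SimGen SimSign (wh_adversary (length (issuers Z)) G H A1 A2) n =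
    hiding_game Z (hiding_chooser (issuers Z) K SG A1) (hiding_guesser (length (issuers Z)) SS A2) n"
proof -
  define h where "h = (\<lambda>J g i q. if i = (0 :: nat) then simulate (length (issuers Z)) SS J g q else Ret Leaf)"
  define finish where "finish = (\<lambda>J g out b. if item 2 (item 0 out) = item 2 (item 1 out) then do {
       let C = (if b then item 1 out else item 0 out);
       salt \<leftarrow> salt_gen Z n;
       b' \<leftarrow> sample (subst_itree (h J g)
         (A2 (tup [unary n, item 2 out, hash Z (tup [item 0 C, item 1 C, item 2 C, salt])])));
       return_pmf (to_bool b' = b)
     } else return_pmf b)"
  \<comment> \<open>The simulated oracle is stateless, and both sides answer registrations by
    \<open>Leaf\<close>.\<close>
  have run_sim: "run (sim_oracle SimSign pk trap)
      (subst_itree (\<lambda>i q. if i = 0 then forward (length (issuers Z)) J q else Ask 1 q Ret) t) () =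
    map_pmf (\<lambda>a. (a, ())) (sample (subst_itree (h J (tup [pk, trap])) t))" for pk trap J t
    by (rule sample_subst_conv_run)
      (auto simp: h_def forward_def simulate_def sim_oracle_def SS[simplified] map_pmf_def
        bind_return_pmf bind_assoc_pmf)
  have "expt_sim (zkLogin_env Z) SimGen SimSign (wh_adversary (length (issuers Z)) G H A1 A2) n = do {
      ops \<leftarrow> sample_providers Z n (issuers Z);
      (pk, trap) \<leftarrow> SimGen n;
      b \<leftarrow> coin;
      out \<leftarrow> sample (A1 (tup [unary n, pk, jwks ops]));
      finish (jwks ops) (tup [pk, trap]) out b
    }"
    unfolding expt_sim_def run_wh_adversary
    by (auto simp: zkLogin_env_def finish_def bind_assoc_pmf bind_return_pmf bind_map_pmf Let_def split_beta H G
        sim_oracle_def run_sim[unfolded sim_oracle_def]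
        if_distrib[of "\<lambda>p. bind_pmf p f" for f] intro!: bind_pmf_cong)
  \<comment> \<open>The claims are chosen without knowledge of \<open>b\<close>, so the coin moves
    behind them; all that precedes it now forms the chooser.\<close>
  also have "\<dots> = do {
      ops \<leftarrow> sample_providers Z n (issuers Z);
      (pk, trap) \<leftarrow> SimGen n;
      out \<leftarrow> sample (A1 (tup [unary n, pk, jwks ops]));
      b \<leftarrow> coin;
      finish (jwks ops) (tup [pk, trap]) out b
    }"
    by (subst bind_commute_pmf) (rule refl)
  also have "\<dots> = do {
      out \<leftarrow> sample (hiding_chooser (issuers Z) K SG A1 (tup [unary n]));
      b \<leftarrow> coin;
      let C0 = decode_claims (item 0 out);
      let C1 = decode_claims (item 1 out);
      salt \<leftarrow> salt_gen Z n;
      b' \<leftarrow> sample (hiding_guesser (length (issuers Z)) SS A2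
        (tup [unary n, item 2 out, address Z (if b then C1 else C0) salt]));
      return_pmf (to_bool b' = b)
    }"
  proof -
    \<comment> \<open>For distinct issuers both sides are a fair coin: the game returns \<open>b\<close>, the guesser \<open>False\<close>.\<close>
    have neq: "bind_pmf coin return_pmf = bind_pmf coin (\<lambda>b. return_pmf (\<not> b))"
      using map_Not_coin by (simp add: map_pmf_def bind_return_pmf')
    show ?thesis
      unfolding hiding_chooser_def hiding_guesser_def finish_def h_def
      apply (simp add: sample_bind sample_sample_jwks[where K = K, OF K[of n]] SG bind_map_pmf
          bind_assoc_pmf bind_return_pmf split_def Let_def address_def)
      apply (rule bind_pmf_cong[OF refl], rule bind_pmf_cong[OF refl], rule bind_pmf_cong[OF refl])
      subgoal for ops g out
      proof (cases "left (right (right (left out))) = left (right (right (left (right out))))")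
        case True
        then show ?thesis
          apply simp
          apply (rule bind_pmf_cong[OF refl])
          subgoal for b
            by (cases b) (simp_all add: Let_def address_def cong: if_cong)
          done
      next
        case False
        then show ?thesis by (simp add: neq bind_return_pmf to_bool_def)
      qed
      done
  qed
  also have "\<dots> = hiding_game Z (hiding_chooser (issuers Z) K SG A1) (hiding_guesser (length (issuers Z)) SS A2) n"
    unfolding hiding_game_def Let_def by (rule bind_commute_pmf)
  finally show ?thesis .
qed

lemma negligible_add_bound:
  assumes "negligible f" "negligible g" "\<And>n. \<bar>h n\<bar> \<le> \<bar>f n\<bar> + \<bar>g n\<bar>"
  shows "negligible h"
  unfolding negligible_def
proof
  fix k :: nat
  \<comment> \<open>The extra power of \<open>n\<close> absorbs the factor 2 of the sum as soon as
    \<open>n\<close> is at least 2.\<close>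
  have "\<forall>\<^sub>F n in sequentially. \<bar>f n\<bar> < 1 / real n ^ Suc k" "\<forall>\<^sub>F n in sequentially. \<bar>g n\<bar> < 1 / real n ^ Suc k"
    using assms(1,2) unfolding negligible_def by blast+
  then show "\<forall>\<^sub>F n in sequentially. \<bar>h n\<bar> < 1 / real n ^ k"
    using eventually_ge_at_top[of 2]
  proof eventually_elim
    case (elim n)
    have "\<bar>h n\<bar> < 2 * (1 / real n ^ Suc k)" using assms(3)[of n] elim(1,2) by linarith
    also have "\<dots> \<le> 1 / real n ^ k" using elim by (simp add: divide_simps)
    finally show ?case .
  qed
qed

text \<open>Key generation of the providers, hash and salts have to be efficient because the
  reductions compute them themselves; JWT correctness makes honestly obtained witnesses satisfy the
  predicate.\<close>

theorem theorem4:
  fixes Z :: setting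
  assumes "jwt_correct (jwt Z)"
    and "ppt_alg unary (\<lambda>(sk, pk). tup [sk, pk]) (jwt_gen (jwt Z))"
    and "ppt_alg id id (\<lambda>x. return_pmf (hash Z x))"
    and "ppt_alg unary id (salt_gen Z)"
    and "witness_hiding (P_zkLogin Z) (zkLogin_env Z) (Sigma_zkLogin Z)"
    and "hiding_addresses Z"
  shows "unlinkable Z"
  unfolding unlinkable_def
proof (intro allI impI)
  fix A1 A2
  assume A1: "ppt A1" and A2: "ppt A2" and legal: "\<forall>n. \<forall>(out, bad) \<in> set_pmf (UL_game Z A1 A2 n). \<not> bad"
  from assms(2) obtain K where K: "ppt K"
    "\<And>n. sample (K (unary n)) = map_pmf (\<lambda>(sk, pk). tup [sk, pk]) (jwt_gen (jwt Z) n)"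
    unfolding ppt_alg_def by blast
  from assms(3) obtain H where H: "ppt H" "\<And>x. sample (H x) = return_pmf (hash Z x)"
    unfolding ppt_alg_def by (auto simp: pmf.map_id)
  from assms(4) obtain G where G: "ppt G" "\<And>n. sample (G (unary n)) = salt_gen Z n"
    unfolding ppt_alg_def by (auto simp: pmf.map_id)
  let ?m = "length (issuers Z)"
  let ?A = "wh_adversary ?m G H A1 A2"
  let ?real = "expt_real (P_zkLogin Z) (zkLogin_env Z) (Sigma_zkLogin Z) ?A"
  note coupled = real_coupled_with_game[OF assms(1) H(2) G(2), of A1 A2]
  have real_eq: "map_pmf fst (?real n) = map_pmf fst (UL_game Z A1 A2 n)" for n
    unfolding pmf.rel_eq[symmetric] pmf.rel_map
    by (rule pmf.rel_mono_strong[OF coupled]) auto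
  \<comment> \<open>Legality is inherited: a raised flag in the real experiment would be matched by
    one in the game.\<close>
  have "\<not> bad" if real: "(out, bad) \<in> set_pmf (?real n)" for n out bad
  proof -
    obtain out' bad' where "(out', bad') \<in> set_pmf (UL_game Z A1 A2 n)" "bad \<longrightarrow> bad'"
      using rel_setD1[OF rel_pmf_imp_rel_set[OF coupled[of n]] real] by auto
    then show ?thesis using legal by blast
  qed
  then have legal_real: "\<forall>n. \<forall>(out, bad) \<in> set_pmf (?real n). \<not> bad" by blast
  obtain SimGen SimSign where Sim:
    "ppt_alg unary (\<lambda>(pk, trap). tup [pk, trap]) SimGen"
    "ppt_alg (\<lambda>(t, pk, trap, m). tup [t, pk, trap, m]) id (\<lambda>(t, pk, trap, m). SimSign t pk trap m)"
    and close: "negligible (\<lambda>n. \<bar>pmf (map_pmf fst (?real n)) True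
      - pmf (expt_sim (zkLogin_env Z) SimGen SimSign ?A n) True\<bar>)"
    using assms(5) ppt_wh_adversary[OF G(1) H(1) A1 A2] legal_real unfolding witness_hiding_def by blast
  \<comment> \<open>The simulators may depend on the first reduction. Programs for them become
    subroutines of the hiding adversary, which is fixed only afterwards.\<close>
  from Sim(1) obtain SG where SG: "ppt SG"
    "\<And>n. sample (SG (unary n)) = map_pmf (\<lambda>(pk, trap). tup [pk, trap]) (SimGen n)"
    unfolding ppt_alg_def by blast
  from Sim(2) obtain SS where SS: "ppt SS"
    "\<And>t pk trap m. sample (SS (tup [t, pk, trap, m])) = SimSign t pk trap m"
    unfolding ppt_alg_def by (auto simp: pmf.map_id simp del: tup_simps)
  have "negligible (\<lambda>n. \<bar>pmf (hiding_game Z (hiding_chooser (issuers Z) K SG A1) (hiding_guesser ?m SS A2) n) True - 1/2\<bar>)"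
    using assms(6) ppt_hiding_chooser[OF K(1) SG(1) A1] ppt_hiding_guesser[OF SS(1) A2]
    unfolding hiding_addresses_def by blast
  \<comment> \<open>The triangle inequality through the simulated experiment.\<close>
  from close this show "negligible (\<lambda>n. \<bar>pmf (map_pmf fst (UL_game Z A1 A2 n)) True - 1/2\<bar>)"
    by (rule negligible_add_bound)
      (simp add: real_eq sim_eq_hiding_game[where H = H and G = G and K = K and SG = SG and SS = SS,
        OF H(2) G(2) K(2) SG(2) SS(2)])
qed

end
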